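(* For every $\theta\in[0,1)$ there exists a generalized Cantor set $C\subset[0,1]$ with Lebesgue measure $m(C)=\theta$ such that, with $I=[0,1]\setminus C$, the determinantal point processes $\mathbb{P}_{K_C}$ and $\mathbb{P}_{K_I}$ on $\mathbb{R}$, with correlation kernels $K_C(x,y)=\widehat{\chi_C}(x-y)$ and $K_I(x,y)=\widehat{\chi_I}(x-y)$ with respect to Lebesgue measure, are both number rigid.
   Context: Generalized Cantor sets. Given $\alpha=\{\alpha_n\}_{n\ge1}$ with $0<\alpha_n<1$, put $C_0=[0,1]$; for $n\ge1$, $C_n$ is obtained from $C_{n-1}$ (a disjoint union of $2^{n-1}$ closed intervals of equal length) by removing from each constituent interval $J$ the open interval with the same midpoint as $J$ and length $\alpha_n$ times the length of $J$. A generalized Cantor set is a set of the form $C=\bigcap_{n\ge1}C_n$ for some such sequence $\alpha$. $m$ denotes Lebesgue measure. Fourier transform: for $g\in L^1(\mathbb{R})$, $\widehat g(\xi)=\int_{\mathbb{R}}g(x)e^{-2\pi i x\xi}\,dx$; $\chi_M$ is the indicator function of $M$. Point processes. $\mathrm{Conf}(\mathbb{R})$ is the space of locally finite configurations $X=\sum_i\delta_{x_i}$ on $\mathbb{R}$ (i.e. $X(\Delta)<\infty$ for every compact $\Delta$), with the vague topology (the weakest topology making $X\mapsto\int f\,dX$ continuous for every compactly supported continuous $f$). A point process on $\mathbb{R}$ is a Borel probability measure on $\mathrm{Conf}(\mathbb{R})$. A configuration is simple if $X(\{x\})\le1$ for all $x$, and is then identified with the subset $\{x_i\}$; a point process is simple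 if almost every configuration is simple. A simple point process $\mathbb{P}$ on $\mathbb{R}$ is determinantal with correlation kernel $K:\mathbb{R}\times\mathbb{R}\to\mathbb{C}$ with respect to Lebesgue measure if for every $n\ge1$ and every bounded compactly supported measurable $\varphi:\mathbb{R}^n\to\mathbb{C}$, $$\mathbb{E}_{\mathbb{P}}\Big[\sum_{x_1,\dots,x_n\in X\text{ distinct}}\varphi(x_1,\dots,x_n)\Big]=\int_{\mathbb{R}^n}\varphi(x_1,\dots,x_n)\det[K(x_i,x_j)]_{1\le i,j\le n}\,dx_1\cdots dx_n .$$ It is denoted $\mathbb{P}_K$. For the kernels $K_C$, $K_I$ the integral operators on $L^2(\mathbb{R})$ are locally trace class, positive and contractive, so by the theorem of Macchi, Soshnikov and Shirai–Takahashi the processes $\mathbb{P}_{K_C}$ and $\mathbb{P}_{K_I}$ exist and are unique. Number rigidity. For a Borel set $S\subset\mathbb{R}$ let $\mathcal{F}_S$ be the $\sigma$-algebra on $\mathrm{Conf}(\mathbb{R})$ generated by the counting functions $\#_B:X\mapsto\#(B\cap X)$, $B\subset S$ Borel, and let $\mathcal{F}_S^{\mathbb{P}}$ be its completion with respect to $\mathbb{P}$. The point process $\mathbb{P}$ is number rigid if for every compact $B\subset\mathbb{R}$ the random variable $\#_B$ is $\mathcal{F}_{\mathbb{R}\setminus B}^{\mathbb{P}}$-measurable. *)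

theory Defs
  imports "HOL-Probability.Probability" "Jordan_Normal_Form.Determinant"
begin

fun cantor_intervals :: "(nat \<Rightarrow> real) \<Rightarrow> nat \<Rightarrow> (real \<times> real) set" where
  "cantor_intervals \<alpha> 0 = {(0, 1)}"
| "cantor_intervals \<alpha> (Suc n) =
     (\<Union>(a, b) \<in> cantor_intervals \<alpha> n.
        {(a, (a + b) / 2 - \<alpha> (Suc n) * (b - a) / 2),
         ((a + b) / 2 + \<alpha> (Suc n) * (b - a) / 2, b)})"

definition cantor_stage :: "(nat \<Rightarrow> real) \<Rightarrow> nat \<Rightarrow> real set" where
  "cantor_stage \<alpha> n = (\<Union>(a, b) \<in> cantor_intervals \<alpha> n. {a..b})"

definition generalized_cantor_set :: "real set \<Rightarrow> bool" where
  "generalized_cantor_set C \<longleftrightarrow>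
     (\<exists>\<alpha>. (\<forall>n\<ge>1. 0 < \<alpha> n \<and> \<alpha> n < 1) \<and> C = (\<Inter>n\<in>{1..}. cantor_stage \<alpha> n))"

definition fourier :: "(real \<Rightarrow> complex) \<Rightarrow> real \<Rightarrow> complex" where
  "fourier g \<xi> = (LINT x|lborel. g x * exp (- 2 * pi * \<i> * x * \<xi>))"

definition fourier_kernel :: "real set \<Rightarrow> real \<Rightarrow> real \<Rightarrow> complex" where
  "fourier_kernel M x y = fourier (indicator M) (x - y)"

text \<open>A configuration is encoded by its multiplicity function: \<open>X x\<close> is the mass
  of the atom at \<open>x\<close>. The measure it stands for is defined on all subsets of the line.\<close>

type_synonym config = "real \<Rightarrow> nat"

definition config_measure :: "config \<Rightarrow> real measure" where
  "config_measure X = point_measure UNIV (\<lambda>x. of_nat (X x))"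

definition Conf :: "config set" where
  "Conf = {X. \<forall>\<Delta>. compact \<Delta> \<longrightarrow> emeasure (config_measure X) \<Delta> < \<infinity>}"

definition vague_topology :: "config topology" where
  "vague_topology = topology_generated_by
     {{X \<in> Conf. (LINT x|config_measure X. f x) \<in> U} | (f :: real \<Rightarrow> real) U.
        continuous_on UNIV f \<and> compact (closure {x. f x \<noteq> 0}) \<and> open U}"

definition vague_borel :: "config measure" where
  "vague_borel = sigma Conf {U. openin vague_topology U}"

definition point_process :: "config measure \<Rightarrow> bool" where
  "point_process P \<longleftrightarrow> prob_space P \<and> space P = Conf \<and> sets P = sets vague_borel"

definition simple_process :: "config measure \<Rightarrow> bool" where
  "simple_process P \<longleftrightarrow> point_process P \<and> (AE X in P. \<forall>x. X x \<le> 1)"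

definition distinct_tuples :: "nat \<Rightarrow> config \<Rightarrow> (nat \<Rightarrow> real) set" where
  "distinct_tuples n X = {x \<in> {..<n} \<rightarrow>\<^sub>E {t. X t \<noteq> 0}. inj_on x {..<n}}"

text \<open>Points of n-space are extensional functions on \<open>{..<n}\<close>. A function there has compact
  support iff it vanishes off some cube. Integrability is part of the defining identity,
  because the Bochner integral of a function that is not integrable is zero by convention.\<close>

definition determinantal ::
    "(real \<Rightarrow> real \<Rightarrow> complex) \<Rightarrow> config measure \<Rightarrow> bool" where
  "determinantal K P \<longleftrightarrow> simple_process P \<and>
     (\<forall>n\<ge>1. \<forall>\<phi> :: (nat \<Rightarrow> real) \<Rightarrow> complex.
        \<phi> \<in> borel_measurable (PiM {..<n} (\<lambda>_. lborel)) \<longrightarrow>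
        bounded (\<phi> ` (\<Pi>\<^sub>E i\<in>{..<n}. UNIV)) \<longrightarrow>
        (\<exists>R. \<forall>x \<in> (\<Pi>\<^sub>E i\<in>{..<n}. UNIV). \<phi> x \<noteq> 0 \<longrightarrow> (\<forall>i<n. \<bar>x i\<bar> \<le> R)) \<longrightarrow>
        integrable (PiM {..<n} (\<lambda>_. lborel))
          (\<lambda>x. \<phi> x * Determinant.det (Matrix.mat n n (\<lambda>(i, j). K (x i) (x j)))) \<and>
        has_bochner_integral P (\<lambda>X. \<Sum>\<^sub>\<infinity>x\<in>distinct_tuples n X. \<phi> x)
          (LINT x|PiM {..<n} (\<lambda>_. lborel).
             \<phi> x * Determinant.det (Matrix.mat n n (\<lambda>(i, j). K (x i) (x j)))))"

definition counting :: "real set \<Rightarrow> config \<Rightarrow> ennreal" where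
  "counting B X = emeasure (config_measure X) B"

definition counting_algebra :: "real set \<Rightarrow> config measure" where
  "counting_algebra S = sigma Conf
     {counting B -` A \<inter> Conf | A B. A \<in> sets borel \<and> B \<in> sets borel \<and> B \<subseteq> S}"

text \<open>Completion with respect to \<open>P\<close> adjoins all \<open>P\<close>-negligible sets of configurations, not
  only subsets of null sets that already lie in \<open>counting_algebra S\<close>. Adjoining just the latter
  would make number rigidity unsatisfiable: sets in \<open>counting_algebra (- B)\<close> do not see the
  points inside \<open>B\<close>.\<close>

definition completed_algebra :: "config measure \<Rightarrow> real set \<Rightarrow> config measure" where
  "completed_algebra P S =
     sigma Conf (sets (counting_algebra S) \<union> null_sets (completion P))"

definition number_rigid :: "config measure \<Rightarrow> bool" where
  "number_rigid P \<longleftrightarrow>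
     (\<forall>B. compact B \<longrightarrow> counting B \<in> borel_measurable (completed_algebra P (- B)))"

end

theory Submission imports Defs
begin

text \<open>
  Let \<open>M\<close> be the spectral set and \<open>w(u) = m({s \<in> M. s - u \<notin> M})\<close>. The variance of a linear
  statistic \<open>\<Sum>F(x)\<close> of the process with kernel \<open>\<chi>\<^sub>M\<close>-hat is \<open>\<integral>|F\<close>-hat\<open>|\<^sup>2 w\<close>, and by the
  Ghosh--Peres argument the process is number rigid once there are test functions tending to 1
  pointwise whose statistics have variance tending to 0.

  If \<open>w(u) \<le> A|u|\<close>, the Gaussians \<open>exp(-\<pi> x\<^sup>2 / L\<^sup>2)\<close> give bounded variances, and
  Gaussians at different dyadic scales \<open>L\<close> are nearly uncorrelated, so averaging over \<open>K\<close> scales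
  gains a factor \<open>1 / K\<close>. A fat Cantor set does not have \<open>w(u) = O(|u|)\<close>, but comparison with its
  \<open>n\<close>-th stage gives \<open>w(u) \<le> 2\<^sup>n |u| + \<epsilon>\<^sub>n\<close>, where \<open>\<epsilon>\<^sub>n\<close> is the measure removed after stage \<open>n\<close>.
  When \<open>\<epsilon>\<^sub>n\<close> decays fast enough, \<open>4\<^sup>n\<close> scales starting at \<open>2\<^sup>n\<close> beat the constant \<open>2\<^sup>n\<close> before
  \<open>\<epsilon>\<^sub>n\<close> is felt. Complementation in \<open>[0,1]\<close> changes \<open>w(u)\<close> by at most \<open>|u|\<close>.
\<close>

section \<open>Cantor sets with prescribed stages\<close>

definition shift_defect :: "real set \<Rightarrow> real \<Rightarrow> real" where
  "shift_defect M u = measure lborel {s \<in> M. s - u \<notin> M}"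

definition left_child :: "real \<Rightarrow> real \<times> real \<Rightarrow> real \<times> real" where
  "left_child r p = (fst p, (fst p + snd p) / 2 - r * (snd p - fst p) / 2)"

definition right_child :: "real \<Rightarrow> real \<times> real \<Rightarrow> real \<times> real" where
  "right_child r p = ((fst p + snd p) / 2 + r * (snd p - fst p) / 2, snd p)"

definition ival :: "real \<times> real \<Rightarrow> real set" where
  "ival p = {fst p..snd p}"

lemma cantor_intervals_Suc':
  "cantor_intervals \<alpha> (Suc n) =
     (\<Union>p\<in>cantor_intervals \<alpha> n. {left_child (\<alpha> (Suc n)) p, right_child (\<alpha> (Suc n)) p})"
  by (auto simp: left_child_def right_child_def)

lemma cantor_stage_ival: "cantor_stage \<alpha> n = (\<Union>p\<in>cantor_intervals \<alpha> n. ival p)"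
  by (auto simp: cantor_stage_def ival_def)

text \<open>Once \<open>d\<close> denotes the length of the removed gap, with \<open>0 < d\<close>
  and \<open>d < b - a\<close>, everything is linear in \<open>a\<close>, \<open>b\<close> and
  \<open>d\<close>. Nonemptiness is recorded because disjoint intervals are known to differ only
  when they are nonempty.\<close>

lemma children:
  assumes "0 < r" "r < 1" "fst p < snd p"
  shows "ival (left_child r p) \<subseteq> ival p" "ival (right_child r p) \<subseteq> ival p"
    "ival (left_child r p) \<inter> ival (right_child r p) = {}"
    "snd (left_child r p) - fst (left_child r p) = (1 - r) * (snd p - fst p) / 2"
    "snd (right_child r p) - fst (right_child r p) = (1 - r) * (snd p - fst p) / 2"
    "ival (left_child r p) \<noteq> {}" "ival (right_child r p) \<noteq> {}"
proof -
  obtain a b where p: "p = (a, b)" by fastforce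
  define d where "d = r * (b - a)"
  have d: "0 < d" "d < b - a"
    using assms mult_strict_right_mono[of r 1 "b - a"] by (auto simp: d_def p)
  have L: "left_child r p = (a, (a + b) / 2 - d / 2)" and R: "right_child r p = ((a + b) / 2 + d / 2, b)"
    by (auto simp: left_child_def right_child_def d_def p)
  show "ival (left_child r p) \<subseteq> ival p" "ival (right_child r p) \<subseteq> ival p"
    "ival (left_child r p) \<inter> ival (right_child r p) = {}"
    "ival (left_child r p) \<noteq> {}" "ival (right_child r p) \<noteq> {}"
    unfolding L R using d by (auto simp: ival_def p field_simps)
  show "snd (left_child r p) - fst (left_child r p) = (1 - r) * (snd p - fst p) / 2"
    "snd (right_child r p) - fst (right_child r p) = (1 - r) * (snd p - fst p) / 2"
    unfolding L R by (simp_all add: d_def p field_simps)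
qed

text \<open>The common length of the intervals of stage \<open>n\<close>: step \<open>k\<close>
  keeps the fraction \<open>1 - \<alpha> k\<close> of an interval and splits what is kept into two
  halves.\<close>

definition stage_len :: "(nat \<Rightarrow> real) \<Rightarrow> nat \<Rightarrow> real" where
  "stage_len \<alpha> n = (\<Prod>k=1..n. 1 - \<alpha> k) / 2 ^ n"

context
  fixes \<alpha> :: "nat \<Rightarrow> real"
  assumes \<alpha>: "\<And>n. n \<ge> 1 \<Longrightarrow> 0 < \<alpha> n \<and> \<alpha> n < 1"
begin

lemma stage_len_pos: "stage_len \<alpha> n > 0"
  unfolding stage_len_def
  by (intro divide_pos_pos prod_pos ballI) (use \<alpha> in \<open>auto simp: Suc_le_eq\<close>)

lemma cantor_intervals_length:
  "p \<in> cantor_intervals \<alpha> n \<Longrightarrow> snd p - fst p = stage_len \<alpha> n"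
proof (induction n arbitrary: p)
  case 0
  then show ?case by (simp add: stage_len_def)
next
  case (Suc n)
  from Suc.prems obtain q where q: "q \<in> cantor_intervals \<alpha> n"
    and p: "p = left_child (\<alpha> (Suc n)) q \<or> p = right_child (\<alpha> (Suc n)) q"
    unfolding cantor_intervals_Suc' by blast
  have l: "snd q - fst q = stage_len \<alpha> n" using Suc.IH q by simp
  with stage_len_pos[of n] have "fst q < snd q" by linarith
  then have "snd p - fst p = (1 - \<alpha> (Suc n)) * stage_len \<alpha> n / 2"
    using p children(4,5)[of "\<alpha> (Suc n)" q] \<alpha>[of "Suc n"] l by auto
  then show ?case by (simp add: stage_len_def mult.commute)
qed

lemma cantor_intervals_less: "p \<in> cantor_intervals \<alpha> n \<Longrightarrow> fst p < snd p"
  using cantor_intervals_length[of p n] stage_len_pos[of n] by simp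

lemma ival_child:
  assumes "p \<in> cantor_intervals \<alpha> n"
    and "p' = left_child (\<alpha> (Suc n)) p \<or> p' = right_child (\<alpha> (Suc n)) p"
  shows "ival p' \<subseteq> ival p" "ival p' \<noteq> {}"
  using assms children[of "\<alpha> (Suc n)" p] \<alpha>[of "Suc n"] cantor_intervals_less[of p n] by auto

text \<open>Induction through the parents: siblings are separated by the removed gap, and intervals
  with different parents lie in intervals that were already disjoint one stage earlier.\<close>

lemma cantor_intervals_disjoint:
  "p \<in> cantor_intervals \<alpha> n \<Longrightarrow> q \<in> cantor_intervals \<alpha> n \<Longrightarrow> p \<noteq> q \<Longrightarrow> ival p \<inter> ival q = {}"
proof (induction n arbitrary: p q)
  case 0
  then show ?case by simp
next
  case (Suc n)
  from Suc.prems obtain p' where p': "p' \<in> cantor_intervals \<alpha> n"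
    and p: "p = left_child (\<alpha> (Suc n)) p' \<or> p = right_child (\<alpha> (Suc n)) p'"
    unfolding cantor_intervals_Suc' by blast
  from Suc.prems obtain q' where q': "q' \<in> cantor_intervals \<alpha> n"
    and q: "q = left_child (\<alpha> (Suc n)) q' \<or> q = right_child (\<alpha> (Suc n)) q'"
    unfolding cantor_intervals_Suc' by blast
  show ?case
  proof (cases "p' = q'")
    case True
    then show ?thesis
      using p q Suc.prems(3) children(3)[of "\<alpha> (Suc n)" p'] \<alpha>[of "Suc n"]
        cantor_intervals_less[OF p'] by auto
  next
    case False
    then show ?thesis
      using Suc.IH[OF p' q'] ival_child(1)[OF p' p] ival_child(1)[OF q' q] by blast
  qed
qed

lemma finite_cantor_intervals: "finite (cantor_intervals \<alpha> n)"
  by (induction n) (auto simp: cantor_intervals_Suc' simp del: cantor_intervals.simps(2))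

text \<open>A stage is a set of pairs, so its size doubles only if no two children coincide.
  Children of different parents are nonempty and lie in disjoint intervals; siblings are nonempty
  and disjoint.\<close>

lemma card_cantor_intervals: "card (cantor_intervals \<alpha> n) = 2 ^ n"
proof (induction n)
  case 0
  then show ?case by simp
next
  case (Suc n)
  have "card (cantor_intervals \<alpha> (Suc n)) =
    (\<Sum>p\<in>cantor_intervals \<alpha> n. card {left_child (\<alpha> (Suc n)) p, right_child (\<alpha> (Suc n)) p})"
    unfolding cantor_intervals_Suc'
  proof (intro card_UN_disjoint finite_cantor_intervals ballI impI)
    fix p q assume pq: "p \<in> cantor_intervals \<alpha> n" "q \<in> cantor_intervals \<alpha> n" "p \<noteq> q"
    show "{left_child (\<alpha> (Suc n)) p, right_child (\<alpha> (Suc n)) p} \<inter>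
        {left_child (\<alpha> (Suc n)) q, right_child (\<alpha> (Suc n)) q} = {}"
    proof (rule equals0I)
      fix x assume "x \<in> {left_child (\<alpha> (Suc n)) p, right_child (\<alpha> (Suc n)) p} \<inter>
        {left_child (\<alpha> (Suc n)) q, right_child (\<alpha> (Suc n)) q}"
      then show False
        using ival_child[OF pq(1), of x] ival_child[OF pq(2), of x]
          cantor_intervals_disjoint[OF pq] by blast
    qed
  qed auto
  also have "\<dots> = (\<Sum>p\<in>cantor_intervals \<alpha> n. 2)"
  proof (rule sum.cong[OF refl])
    fix p assume p: "p \<in> cantor_intervals \<alpha> n"
    have "left_child (\<alpha> (Suc n)) p \<noteq> right_child (\<alpha> (Suc n)) p"
      using children(3,6)[of "\<alpha> (Suc n)" p] \<alpha>[of "Suc n"] cantor_intervals_less[OF p] by auto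
    then show "card {left_child (\<alpha> (Suc n)) p, right_child (\<alpha> (Suc n)) p} = 2" by simp
  qed
  finally show ?case using Suc.IH by simp
qed

lemma closed_cantor_stage: "closed (cantor_stage \<alpha> n)"
  unfolding cantor_stage_ival ival_def by (intro closed_UN finite_cantor_intervals ballI) simp

lemma cantor_stage_Suc_subset: "cantor_stage \<alpha> (Suc n) \<subseteq> cantor_stage \<alpha> n"
  unfolding cantor_stage_ival cantor_intervals_Suc' using ival_child(1) by fastforce

lemma decseq_cantor_stage: "decseq (cantor_stage \<alpha>)"
  by (rule decseq_SucI) (rule cantor_stage_Suc_subset)

lemma cantor_stage_0: "cantor_stage \<alpha> 0 = {0..1}"
  by (simp add: cantor_stage_def)

lemma emeasure_cantor_stage:
  "emeasure lborel (cantor_stage \<alpha> n) = ennreal (\<Prod>k=1..n. 1 - \<alpha> k)"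
proof -
  have "emeasure lborel (cantor_stage \<alpha> n) = (\<Sum>p\<in>cantor_intervals \<alpha> n. emeasure lborel (ival p))"
    unfolding cantor_stage_ival
  proof (rule sum_emeasure[symmetric])
    show "disjoint_family_on ival (cantor_intervals \<alpha> n)"
      using cantor_intervals_disjoint by (auto simp: disjoint_family_on_def)
  qed (auto simp: finite_cantor_intervals ival_def)
  also have "\<dots> = (\<Sum>p\<in>cantor_intervals \<alpha> n. ennreal (stage_len \<alpha> n))"
    by (intro sum.cong refl) (simp add: ival_def cantor_intervals_less less_imp_le cantor_intervals_length)
  also have "\<dots> = ennreal (2 ^ n * stage_len \<alpha> n)"
    using stage_len_pos[of n] by (simp add: card_cantor_intervals ennreal_mult flip: ennreal_power)
  finally show ?thesis by (simp add: stage_len_def)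
qed

text \<open>A point that leaves the stage when moved by \<open>- u\<close> leaves its own interval,
  so it lies within |u| of the endpoint that it crosses: the left one for \<open>u \<ge> 0\<close>,
  the right one otherwise. Each of the \<open>2 ^ n\<close> intervals thus contributes one piece
  \<open>?J p\<close> of length |u|.\<close>

lemma emeasure_stage_shift:
  "emeasure lborel {s \<in> cantor_stage \<alpha> n. s - u \<notin> cantor_stage \<alpha> n} \<le> ennreal (2 ^ n * \<bar>u\<bar>)"
proof -
  let ?J = "\<lambda>p. if u \<ge> 0 then {fst p..fst p + u} else {snd p + u..snd p}"
  have "emeasure lborel {s \<in> cantor_stage \<alpha> n. s - u \<notin> cantor_stage \<alpha> n}
      \<le> emeasure lborel (\<Union>p\<in>cantor_intervals \<alpha> n. ?J p)"
  proof (rule emeasure_mono)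
    show "{s \<in> cantor_stage \<alpha> n. s - u \<notin> cantor_stage \<alpha> n} \<subseteq> (\<Union>p\<in>cantor_intervals \<alpha> n. ?J p)"
    proof
      fix s assume s: "s \<in> {s \<in> cantor_stage \<alpha> n. s - u \<notin> cantor_stage \<alpha> n}"
      then obtain p where p: "p \<in> cantor_intervals \<alpha> n" "s \<in> ival p"
        by (auto simp: cantor_stage_ival)
      then have "s - u \<notin> ival p" using s by (auto simp: cantor_stage_ival)
      then have "s \<in> ?J p" using p(2) by (auto simp: ival_def)
      then show "s \<in> (\<Union>p\<in>cantor_intervals \<alpha> n. ?J p)" using p(1) by blast
    qed
  qed (intro sets.finite_UN finite_cantor_intervals, simp)
  also have "\<dots> \<le> (\<Sum>p\<in>cantor_intervals \<alpha> n. emeasure lborel (?J p))"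
    by (rule emeasure_subadditive_finite) (auto simp: finite_cantor_intervals)
  also have "\<dots> = (\<Sum>p\<in>cantor_intervals \<alpha> n. ennreal \<bar>u\<bar>)"
    by (intro sum.cong) auto
  also have "\<dots> = ennreal (2 ^ n * \<bar>u\<bar>)"
    by (simp add: card_cantor_intervals ennreal_mult flip: ennreal_power)
  finally show ?thesis .
qed

end

lemma cantor_set_exists:
  fixes \<theta> :: real and \<epsilon> :: "nat \<Rightarrow> real"
  assumes \<theta>: "0 \<le> \<theta>" "\<theta> < 1"
    and \<epsilon>: "\<epsilon> 0 = 1" "\<And>n. 0 < \<epsilon> n" "\<And>n. \<epsilon> (Suc n) < \<epsilon> n" "\<epsilon> \<longlonglongrightarrow> 0"
  obtains C where "generalized_cantor_set C" "C \<in> sets borel" "C \<subseteq> {0..1}" "measure lborel C = \<theta>"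
    "\<And>n u. shift_defect C u \<le> 2 ^ n * \<bar>u\<bar> + \<epsilon> n"
proof -
  \<comment> \<open>\<open>\<mu> n\<close> is the intended measure of stage \<open>n\<close>: it is
    1 at \<open>n = 0\<close> because \<open>\<epsilon> 0 = 1\<close>, decreases strictly and tends
    to \<theta>. The removed proportions \<open>\<alpha> n\<close> are read off from successive
    ratios.\<close>
  define \<mu> where "\<mu> n = \<theta> + (1 - \<theta>) * \<epsilon> n" for n
  define \<alpha> where "\<alpha> n = 1 - \<mu> n / \<mu> (n - 1)" for n
  have \<mu>_pos: "\<mu> n > 0" for n
    unfolding \<mu>_def using \<theta> \<epsilon>(2)[of n] by (simp add: add_nonneg_pos)
  have \<mu>_dec: "\<mu> (Suc n) < \<mu> n" for n
    unfolding \<mu>_def using \<theta> \<epsilon>(3)[of n] by simp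
  have \<alpha>: "0 < \<alpha> n \<and> \<alpha> n < 1" if "n \<ge> 1" for n
  proof -
    from that obtain k where "n = Suc k" by (cases n) auto
    then show ?thesis using \<mu>_pos[of k] \<mu>_pos[of "Suc k"] \<mu>_dec[of k] by (simp add: \<alpha>_def field_simps)
  qed
  have prod: "(\<Prod>k=1..n. 1 - \<alpha> k) = \<mu> n" for n
  proof (induction n)
    case 0
    then show ?case by (simp add: \<mu>_def \<epsilon>(1))
  next
    case (Suc n)
    then show ?case using \<mu>_pos[of n] by (simp add: \<alpha>_def)
  qed
  let ?S = "cantor_stage \<alpha>"
  define C where "C = (\<Inter>n\<in>{1..}. ?S n)"
  note fc = closed_cantor_stage[where \<alpha>=\<alpha>, OF \<alpha>]
  have [measurable]: "?S n \<in> sets borel" for n using fc by (simp add: borel_closed)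
  have sub: "C \<subseteq> ?S n" for n
  proof -
    have "C \<subseteq> ?S (Suc n)" by (auto simp: C_def)
    then show ?thesis using cantor_stage_Suc_subset[where \<alpha>=\<alpha>, OF \<alpha>, of n] by blast
  qed
  have CI: "C = (\<Inter>n. ?S n)" using sub by (auto simp: C_def)
  have [measurable]: "C \<in> sets borel" unfolding CI by measurable
  have em: "emeasure lborel (?S n) = ennreal (\<mu> n)" for n
    using emeasure_cantor_stage[where \<alpha>=\<alpha>, OF \<alpha>, of n] prod by simp
  have "(\<lambda>n. emeasure lborel (?S n)) \<longlonglongrightarrow> emeasure lborel C"
    unfolding CI by (rule Lim_emeasure_decseq) (auto simp: decseq_cantor_stage[where \<alpha>=\<alpha>, OF \<alpha>] em)
  moreover have "(\<lambda>n. emeasure lborel (?S n)) \<longlonglongrightarrow> ennreal \<theta>"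
    unfolding em \<mu>_def by (rule tendsto_eq_intros \<epsilon>(4) refl | simp)+
  ultimately have emC: "emeasure lborel C = ennreal \<theta>" by (rule LIMSEQ_unique)
  have "shift_defect C u \<le> 2 ^ n * \<bar>u\<bar> + \<epsilon> n" for n u
  proof -
    \<comment> \<open>A point of \<open>C\<close> that is moved out of \<open>C\<close> either
      leaves stage \<open>n\<close> as well (\<open>?A\<close>) or lands in the part of stage
      \<open>n\<close> that is deleted later. The points of the second kind lie in
      \<open>?B\<close>, a translate of \<open>?S n - C\<close>, of measure
      \<open>\<mu> n - \<theta> \<le> \<epsilon> n\<close>.\<close>
    let ?A = "{s \<in> ?S n. s - u \<notin> ?S n}" and ?B = "{s. s - u \<in> ?S n - C}"
    have "{s \<in> C. s - u \<notin> C} \<subseteq> ?A \<union> ?B" using sub[of n] by auto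
    then have "emeasure lborel {s \<in> C. s - u \<notin> C} \<le> emeasure lborel (?A \<union> ?B)"
      by (rule emeasure_mono) measurable
    also have "\<dots> \<le> emeasure lborel ?A + emeasure lborel ?B"
      by (rule emeasure_subadditive) measurable
    also have "emeasure lborel ?B = emeasure lborel (?S n - C)"
    proof -
      have "emeasure lborel (?S n - C) = emeasure (distr lborel borel ((+) u)) {s. s - u \<in> ?S n - C}"
        by (subst emeasure_distr) (auto intro!: arg_cong[where f="emeasure lborel"])
      then show ?thesis by (simp only: lborel_distr_plus)
    qed
    also have "\<dots> = ennreal (\<mu> n - \<theta>)"
      using sub[of n] \<theta> by (subst emeasure_Diff) (auto simp: emC em ennreal_minus)
    also have "\<dots> \<le> ennreal (\<epsilon> n)"
      using \<theta> \<epsilon>(2)[of n] by (intro ennreal_leI) (simp add: \<mu>_def algebra_simps)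
    also have "emeasure lborel ?A \<le> ennreal (2 ^ n * \<bar>u\<bar>)"
      by (rule emeasure_stage_shift[where \<alpha>=\<alpha>, OF \<alpha>])
    finally have "emeasure lborel {s \<in> C. s - u \<notin> C} \<le> ennreal (2 ^ n * \<bar>u\<bar> + \<epsilon> n)"
      using \<epsilon>(2)[of n] by (simp add: ennreal_plus less_imp_le add_mono)
    then show ?thesis
      unfolding shift_defect_def measure_def using \<epsilon>(2)[of n] by (intro enn2real_leI) auto
  qed
  moreover have "generalized_cantor_set C"
    unfolding generalized_cantor_set_def C_def using \<alpha> by blast
  ultimately show ?thesis
    using that[of C] sub[of 0] emC \<theta> cantor_stage_0[where \<alpha>=\<alpha>, OF \<alpha>] by (simp add: measure_def)
qed

section \<open>A variance criterion for number rigidity\<close>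

lemma config_measure_simps [simp]: "space (config_measure X) = UNIV" "sets (config_measure X) = UNIV"
  by (simp_all add: config_measure_def space_point_measure sets_point_measure)

lemma measurable_config_measure [simp]: "f \<in> borel_measurable (config_measure X)"
  by (simp add: measurable_def)

text \<open>Each atom has mass at least 1, so infinitely many atoms in a compact set would give it
  infinite mass, which \<open>Conf\<close> excludes.\<close>

lemma finite_Conf:
  assumes "X \<in> Conf" "compact D"
  shows "finite {t \<in> D. X t \<noteq> 0}"
proof (rule ccontr)
  assume inf: "infinite {t \<in> D. X t \<noteq> 0}"
  have "of_nat n \<le> emeasure (config_measure X) D" for n
  proof -
    obtain F where F: "F \<subseteq> {t \<in> D. X t \<noteq> 0}" "finite F" "card F = n"
      using infinite_arbitrarily_large[OF inf] by blast
    have "(of_nat n :: ennreal) = (\<Sum>t\<in>F. 1)" using F by simp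
    also have "\<dots> \<le> (\<Sum>t\<in>F. of_nat (X t))"
    proof (rule sum_mono)
      fix t assume "t \<in> F"
      then have "1 \<le> X t" using F by auto
      then have "of_nat 1 \<le> (of_nat (X t) :: ennreal)" by (rule of_nat_mono)
      then show "1 \<le> (of_nat (X t) :: ennreal)" by simp
    qed
    also have "\<dots> = emeasure (config_measure X) F"
      unfolding config_measure_def using F by (subst emeasure_point_measure_finite2) auto
    also have "\<dots> \<le> emeasure (config_measure X) D"
      using F by (intro emeasure_mono) auto
    finally show ?thesis .
  qed
  then have "emeasure (config_measure X) D = \<top>"
    using ennreal_Ex_less_of_nat[of "emeasure (config_measure X) D"] by (meson leD less_top)
  then show False using assms by (auto simp: Conf_def)
qed

text \<open>Reduces the linear statistic of a simple configuration to a finite real sum, the form in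
  which statistics are split and compared below.\<close>

lemma nn_integral_config:
  assumes "finite {t \<in> A. X t \<noteq> 0}" "\<And>t. X t \<le> 1" "\<And>t. 0 \<le> f t" "\<And>t. t \<notin> A \<Longrightarrow> f t = 0"
  shows "(\<integral>\<^sup>+t. ennreal (f t) \<partial>config_measure X) = ennreal (\<Sum>t | t \<in> A \<and> X t \<noteq> 0. f t)"
proof -
  have one: "X t = 1" if "X t \<noteq> 0" for t using assms(2)[of t] that by linarith
  have sub: "{t. 0 < (of_nat (X t) :: ennreal) \<and> 0 < ennreal (f t)} \<subseteq> {t \<in> A. X t \<noteq> 0}"
    using assms(4) by force
  have "(\<integral>\<^sup>+t. ennreal (f t) \<partial>config_measure X) =
      (\<Sum>t | 0 < (of_nat (X t) :: ennreal) \<and> 0 < ennreal (f t). of_nat (X t) * ennreal (f t))"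
    unfolding config_measure_def
    by (subst nn_integral_point_measure) (use finite_subset[OF sub assms(1)] in auto)
  also have "\<dots> = (\<Sum>t | t \<in> A \<and> X t \<noteq> 0. of_nat (X t) * ennreal (f t))"
    using assms(1) sub by (intro sum.mono_neutral_left) (auto simp: ennreal_eq_0_iff not_less)
  also have "\<dots> = (\<Sum>t | t \<in> A \<and> X t \<noteq> 0. ennreal (f t))"
    by (intro sum.cong refl) (auto simp: one)
  also have "\<dots> = ennreal (\<Sum>t | t \<in> A \<and> X t \<noteq> 0. f t)"
    using assms(3) by (simp add: sum_ennreal)
  finally show ?thesis .
qed

lemma counting_simple:
  assumes "finite {t \<in> B. X t \<noteq> 0}" "\<And>t. X t \<le> 1"
  shows "counting B X = ennreal (real (card {t \<in> B. X t \<noteq> 0}))"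
proof -
  have "counting B X = (\<integral>\<^sup>+t. ennreal (indicator B t) \<partial>config_measure X)"
    by (simp add: counting_def ennreal_indicator)
  also have "\<dots> = ennreal (\<Sum>t | t \<in> B \<and> X t \<noteq> 0. indicator B t)"
    using assms by (intro nn_integral_config) auto
  also have "(\<Sum>t | t \<in> B \<and> X t \<noteq> 0. indicator B t) = (\<Sum>t | t \<in> B \<and> X t \<noteq> 0. (1::real))"
    by (intro sum.cong) auto
  finally show ?thesis by simp
qed

section \<open>Measurability with respect to the counting algebras\<close>

lemma counting_algebra_space: "space (counting_algebra S) = Conf"
  unfolding counting_algebra_def by (rule space_measure_of) auto

lemma counting_measurable:
  assumes "B \<in> sets borel" "B \<subseteq> S"
  shows "counting B \<in> borel_measurable (counting_algebra S)"
proof (rule measurableI)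
  fix A :: "ennreal set" assume "A \<in> sets borel"
  then show "counting B -` A \<inter> space (counting_algebra S) \<in> sets (counting_algebra S)"
    unfolding counting_algebra_space unfolding counting_algebra_def
    by (subst sets_measure_of) (use assms in \<open>auto intro!: sigma_sets.Basic\<close>)
qed simp

text \<open>A statistic cut off to \<open>S\<close> sees only the points in \<open>S\<close>: for
  the indicator of \<open>A\<close> it is the counting function of \<open>A \<inter> S\<close>, and
  sums, multiples and monotone limits give the rest.\<close>

lemma config_integral_measurable:
  assumes [measurable]: "S \<in> sets borel" and "f \<in> borel_measurable borel"
  shows "(\<lambda>X. \<integral>\<^sup>+t. f t * indicator S t \<partial>config_measure X) \<in> borel_measurable (counting_algebra S)"
  using assms(2)
proof (induction f rule: borel_measurable_induct)
  case (cong f g)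
  then have "f = g" by auto
  then show ?case using cong by simp
next
  case (set A)
  then have [measurable]: "A \<in> sets borel" by simp
  have "(\<integral>\<^sup>+t. indicator A t * indicator S t \<partial>config_measure X) = counting (A \<inter> S) X" for X
    by (simp add: counting_def flip: indicator_inter_arith)
  then show ?case by (simp add: counting_measurable)
next
  case (mult u c)
  then have [measurable]: "(\<lambda>X. \<integral>\<^sup>+t. u t * indicator S t \<partial>config_measure X)
      \<in> borel_measurable (counting_algebra S)" by simp
  show ?case unfolding mult.assoc by (subst nn_integral_cmult) simp_all
next
  case (add u v)
  then have [measurable]: "(\<lambda>X. \<integral>\<^sup>+t. u t * indicator S t \<partial>config_measure X)
      \<in> borel_measurable (counting_algebra S)" "(\<lambda>X. \<integral>\<^sup>+t. v t * indicator S t \<partial>config_measure X)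
      \<in> borel_measurable (counting_algebra S)" by simp_all
  show ?case unfolding distrib_right by (subst nn_integral_add) simp_all
next
  case (seq U)
  have "(\<integral>\<^sup>+t. (SUP i. U i) t * indicator S t \<partial>config_measure X) =
      (SUP i. \<integral>\<^sup>+t. U i t * indicator S t \<partial>config_measure X)" for X
  proof -
    have "(\<integral>\<^sup>+t. (SUP i. U i) t * indicator S t \<partial>config_measure X) =
        (\<integral>\<^sup>+t. (SUP i. U i t * indicator S t) \<partial>config_measure X)"
      by (intro nn_integral_cong) (simp add: SUP_mult_right_ennreal image_image)
    also have "\<dots> = (SUP i. \<integral>\<^sup>+t. U i t * indicator S t \<partial>config_measure X)"
      using \<open>incseq U\<close>
      by (intro nn_integral_monotone_convergence_SUP)
        (auto simp: incseq_def le_fun_def intro!: mult_right_mono)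
    finally show ?thesis .
  qed
  then show ?case using seq by (simp add: borel_measurable_SUP)
qed

text \<open>\<open>h\<close> and \<open>g\<close> differ only inside a null set, and every subset of
  a null set is itself a generator of the completed algebra. A preimage under \<open>h\<close> is
  thus a preimage under \<open>g\<close>, corrected by such sets.\<close>

lemma completed_measurable:
  fixes g h :: "config \<Rightarrow> ennreal"
  assumes P: "space P = Conf" and g: "g \<in> borel_measurable (counting_algebra S)"
    and ae: "AE X in P. h X = g X"
  shows "h \<in> borel_measurable (completed_algebra P S)"
proof -
  obtain N where N: "N \<in> null_sets P" and hg: "\<And>X. X \<in> Conf - N \<Longrightarrow> h X = g X"
    by (rule AE_E3[OF ae]) (use P in auto)
  let ?G = "sets (counting_algebra S) \<union> null_sets (completion P)"
  have G: "?G \<subseteq> Pow Conf"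
    using sets.space_closed[of "counting_algebra S"] sets.space_closed[of "completion P"] P
    by (auto simp: counting_algebra_space null_sets_def)
  have sp: "space (completed_algebra P S) = Conf"
    unfolding completed_algebra_def using G by (rule space_measure_of)
  have st: "sets (completed_algebra P S) = sigma_sets Conf ?G"
    unfolding completed_algebra_def using G by (rule sets_measure_of)
  have basic: "Y \<in> sets (completed_algebra P S)" if "Y \<in> ?G" for Y
    unfolding st using that by (rule sigma_sets.Basic)
  have N': "N \<in> null_sets (completion P)" using N by (rule null_sets_completionI)
  show ?thesis
  proof (rule measurableI)
    fix A :: "ennreal set" assume A: "A \<in> sets borel"
    have 1: "g -` A \<inter> Conf \<in> sets (completed_algebra P S)"
      using measurable_sets[OF g A] by (intro basic) (simp add: counting_algebra_space)
    have 2: "h -` A \<inter> Conf \<inter> N \<in> sets (completed_algebra P S)"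
      using null_sets_completion_subset[of "h -` A \<inter> Conf \<inter> N" N P] N' by (intro basic) auto
    have 3: "N \<in> sets (completed_algebra P S)" using N' by (intro basic) auto
    have "h -` A \<inter> space (completed_algebra P S) = (g -` A \<inter> Conf - N) \<union> (h -` A \<inter> Conf \<inter> N)"
      unfolding sp using hg by auto
    then show "h -` A \<inter> space (completed_algebra P S) \<in> sets (completed_algebra P S)"
      using 1 2 3 by auto
  qed simp
qed

text \<open>\<open>V n\<close> is the squared deviation of the linear statistic up to a null set only: the determinantal
  identity yields such a measurable version without any measurability of counting functions
  with respect to the vague topology.\<close>

theorem number_rigid_criterion:
  fixes f :: "nat \<Rightarrow> real \<Rightarrow> real" and R c :: "nat \<Rightarrow> real" and V :: "nat \<Rightarrow> config \<Rightarrow> real"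
  assumes P: "simple_process P"
    and f [measurable]: "\<And>n. f n \<in> borel_measurable borel"
    and f_nonneg: "\<And>n t. 0 \<le> f n t"
    and supp: "\<And>n t. \<bar>t\<bar> > R n \<Longrightarrow> f n t = 0"
    and f_lim: "\<And>t. (\<lambda>n. f n t) \<longlonglongrightarrow> 1"
    and V_eq: "\<And>n. AE X in P. V n X = (enn2real (\<integral>\<^sup>+t. ennreal (f n t) \<partial>config_measure X) - c n)\<^sup>2"
    and V_int: "\<And>n. integrable P (V n)"
    and V_lim: "(\<lambda>n. LINT X|P. V n X) \<longlonglongrightarrow> 0"
  shows "number_rigid P"
  unfolding number_rigid_def
proof (intro allI impI)
  fix B :: "real set" assume B: "compact B"
  then have [measurable]: "B \<in> sets borel" by (simp add: borel_compact)
  have spP: "space P = Conf" and simple: "AE X in P. \<forall>x. X x \<le> 1"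
    using P by (auto simp: simple_process_def point_process_def)
  \<comment> \<open>\<open>S\<close> is the full statistic and \<open>T\<close> its part outside
    \<open>B\<close>, which the exterior configuration determines.\<close>
  define S where "S n X = enn2real (\<integral>\<^sup>+t. ennreal (f n t) \<partial>config_measure X)" for n X
  define T where "T n X = (\<integral>\<^sup>+t. ennreal (f n t) * indicator (- B) t \<partial>config_measure X)" for n X
  \<comment> \<open>\<open>V n\<close> is almost surely a square, so its integral is its
    \<open>L^1\<close> norm. Convergence in \<open>L^1\<close> gives almost sure convergence along a
    subsequence \<open>r\<close>.\<close>
  obtain r :: "nat \<Rightarrow> nat" where r: "strict_mono r" and
    r_lim: "AE X in P. (\<lambda>k. (S (r k) X - c (r k))\<^sup>2) \<longlonglongrightarrow> 0"
  proof -
    have "(LINT X|P. norm (V n X)) = (LINT X|P. V n X)" for n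
    proof (rule integral_cong_AE)
      show "AE X in P. norm (V n X) = V n X" using V_eq[of n] by eventually_elim simp
    qed (use V_int[of n] in auto)
    then have "\<exists>r::nat\<Rightarrow>nat. strict_mono r \<and> (AE X in P. (\<lambda>k. V (r k) X) \<longlonglongrightarrow> 0)"
      using V_int V_lim by (intro tendsto_L1_AE_subseq) simp_all
    then obtain r :: "nat \<Rightarrow> nat" where r: "strict_mono r" "AE X in P. (\<lambda>k. V (r k) X) \<longlonglongrightarrow> 0" by blast
    have "AE X in P. \<forall>n. V n X = (S n X - c n)\<^sup>2"
      using V_eq by (simp add: AE_all_countable S_def)
    with r(2) have "AE X in P. (\<lambda>k. (S (r k) X - c (r k))\<^sup>2) \<longlonglongrightarrow> 0"
      by eventually_elim simp
    with r(1) show ?thesis by (rule that)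
  qed
  have T_meas [measurable]: "T n \<in> borel_measurable (counting_algebra (- B))" for n
    unfolding T_def by (rule config_integral_measurable) measurable
  \<comment> \<open>Since \<open>S n - c n\<close> tends to 0 along \<open>r\<close>, the number of
    points in \<open>B\<close> must be the limit of \<open>c n\<close> minus the exterior part. As
    \<open>lim\<close> is total, \<open>G\<close> is defined and measurable also where the sequence
    diverges.\<close>
  define G where "G X = ennreal (lim (\<lambda>k. c (r k) - enn2real (T (r k) X)))" for X
  have "G \<in> borel_measurable (counting_algebra (- B))"
    unfolding G_def by measurable
  moreover have "AE X in P. counting B X = G X"
    using simple r_lim AE_space
  proof eventually_elim
    case (elim X)
    have X: "X \<in> Conf" using elim spP by simp
    have finB: "finite {t \<in> B. X t \<noteq> 0}" using X B by (rule finite_Conf)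
    \<comment> \<open>The statistic is its exterior part plus its sum over \<open>B\<close>. In this
      arrangement the sum over \<open>B\<close> tends to the number of points in \<open>B\<close>,
      because \<open>f n\<close> tends to 1 at each of these finitely many points, and the other
      term tends to 0 along \<open>r\<close>.\<close>
    have eq: "c n - enn2real (T n X) = (\<Sum>t | t \<in> B \<and> X t \<noteq> 0. f n t) - (S n X - c n)" for n
    proof -
      let ?A = "{- R n..R n}"
      have finA: "finite {t \<in> ?A. X t \<noteq> 0}" using X by (rule finite_Conf) simp
      have z: "f n t = 0" if "t \<notin> ?A" for t using that by (intro supp) auto
      have T: "T n X = ennreal (\<Sum>t | t \<in> ?A \<and> X t \<noteq> 0. f n t * indicator (- B) t)"
        unfolding T_def using finA elim(1) f_nonneg z
        by (subst nn_integral_config[symmetric]) (auto simp: ennreal_mult ennreal_indicator)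
      have S: "S n X = (\<Sum>t | t \<in> ?A \<and> X t \<noteq> 0. f n t)"
        unfolding S_def using finA elim(1) f_nonneg z
        by (subst nn_integral_config[where A="?A"]) (auto simp: sum_nonneg)
      have "(\<Sum>t | t \<in> B \<and> X t \<noteq> 0. f n t) = (\<Sum>t | t \<in> B \<inter> ?A \<and> X t \<noteq> 0. f n t)"
        using finB z by (intro sum.mono_neutral_right) auto
      also have "\<dots> = (\<Sum>t | t \<in> B \<inter> ?A \<and> X t \<noteq> 0. f n t * indicator B t)"
        by (intro sum.cong) auto
      also have "\<dots> = (\<Sum>t | t \<in> ?A \<and> X t \<noteq> 0. f n t * indicator B t)"
        using finA by (intro sum.mono_neutral_left) (auto simp: indicator_def)
      finally have "S n X = enn2real (T n X) + (\<Sum>t | t \<in> B \<and> X t \<noteq> 0. f n t)"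
        unfolding S T using f_nonneg
        by (subst enn2real_ennreal) (auto intro!: sum_nonneg sum.cong simp: indicator_def simp flip: sum.distrib)
      then show ?thesis by simp
    qed
    have "(\<lambda>k. S (r k) X - c (r k)) \<longlonglongrightarrow> 0"
      using elim(2) by (simp add: tendsto_power_zero power_tendsto_0_iff)
    moreover have "(\<lambda>k. \<Sum>t | t \<in> B \<and> X t \<noteq> 0. f (r k) t) \<longlonglongrightarrow> (\<Sum>t | t \<in> B \<and> X t \<noteq> 0. 1)"
      using LIMSEQ_subseq_LIMSEQ[OF f_lim r] by (intro tendsto_sum) (simp add: o_def)
    ultimately have "(\<lambda>k. c (r k) - enn2real (T (r k) X)) \<longlonglongrightarrow> (\<Sum>t | t \<in> B \<and> X t \<noteq> 0. 1) - 0"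
      unfolding eq by (intro tendsto_diff)
    then have "lim (\<lambda>k. c (r k) - enn2real (T (r k) X)) = real (card {t \<in> B. X t \<noteq> 0})"
      by (intro limI) simp
    then show ?case
      using counting_simple[OF finB] elim(1) by (simp add: G_def)
  qed
  ultimately show "counting B \<in> borel_measurable (completed_algebra P (- B))"
    by (intro completed_measurable[OF spP])
qed

section \<open>Variance of linear statistics of determinantal processes\<close>

lemma det_mat_2:
  fixes a :: "nat \<Rightarrow> nat \<Rightarrow> 'a :: comm_ring_1"
  shows "Determinant.det (Matrix.mat 2 2 (\<lambda>(i, j). a i j)) = a 0 0 * a 1 1 - a 0 1 * a 1 0"
proof -
  let ?A = "Matrix.mat 2 2 (\<lambda>(i, j). a i j)"
  have A: "?A \<in> carrier_mat 2 2" by simp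
  have "Determinant.det (mat_delete ?A 0 0) = a 1 1"
    by (subst det_single) (auto simp: mat_delete_def)
  moreover have "Determinant.det (mat_delete ?A 0 1) = a 1 0"
    by (subst det_single) (auto simp: mat_delete_def)
  ultimately show ?thesis
    by (subst laplace_expansion_row[OF A, of 0]) (auto simp: cofactor_def numeral_2_eq_2)
qed

lemma det_mat_1:
  "Determinant.det (Matrix.mat 1 1 (\<lambda>(i, j). a i j)) = a 0 0"
  by (subst det_single) auto

text \<open>As \<open>f\<close> vanishes off \<open>A\<close>, only the finitely many points in
  \<open>A\<close> contribute; \<open>c\<close> makes a point into the extensional 1-tuple that
  encodes it.\<close>

lemma infsum_distinct_tuples_1:
  fixes f :: "real \<Rightarrow> complex"
  assumes fin: "finite {t \<in> A. X t \<noteq> 0}" and z: "\<And>t. t \<notin> A \<Longrightarrow> f t = 0"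
  shows "(\<Sum>\<^sub>\<infinity>x\<in>distinct_tuples 1 X. f (x 0)) = (\<Sum>t | t \<in> A \<and> X t \<noteq> 0. f t)"
proof -
  let ?Z = "{t \<in> A. X t \<noteq> 0}"
  define c where "c t = (\<lambda>i\<in>{..<1::nat}. t)" for t :: real
  have inj: "inj_on c ?Z" by (auto simp: inj_on_def c_def fun_eq_iff restrict_def split: if_splits)
  have "(\<Sum>\<^sub>\<infinity>x\<in>distinct_tuples 1 X. f (x 0)) = (\<Sum>\<^sub>\<infinity>x\<in>c ` ?Z. f (x 0))"
  proof (rule infsum_cong_neutral)
    fix x assume "x \<in> c ` ?Z - distinct_tuples 1 X"
    then obtain t where t: "t \<in> ?Z" "x = c t" by blast
    have "x \<in> distinct_tuples 1 X"
      using t by (auto simp: distinct_tuples_def c_def inj_on_def)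
    then show "f (x 0) = 0" using \<open>x \<in> c ` ?Z - distinct_tuples 1 X\<close> by blast
  next
    fix x assume x: "x \<in> distinct_tuples 1 X - c ` ?Z"
    show "f (x 0) = 0"
    proof (rule ccontr)
      assume "f (x 0) \<noteq> 0"
      then have "x 0 \<in> ?Z" using x z by (auto simp: distinct_tuples_def)
      moreover have "x = c (x 0)"
        using x by (auto simp: distinct_tuples_def c_def fun_eq_iff restrict_def PiE_def extensional_def)
      ultimately show False using x by blast
    qed
  qed simp
  also have "\<dots> = (\<Sum>x\<in>c ` ?Z. f (x 0))" using fin by (intro infsum_finite) auto
  also have "\<dots> = (\<Sum>t\<in>?Z. f t)" using inj by (subst sum.reindex) (auto simp: c_def)
  finally show ?thesis .
qed

text \<open>Pairs of distinct points are all pairs minus the diagonal, and the sum over all pairs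
  factors into a square.\<close>

lemma infsum_distinct_tuples_2:
  fixes f :: "real \<Rightarrow> complex"
  assumes fin: "finite {t \<in> A. X t \<noteq> 0}" and z: "\<And>t. t \<notin> A \<Longrightarrow> f t = 0"
  shows "(\<Sum>\<^sub>\<infinity>x\<in>distinct_tuples 2 X. f (x 0) * f (x 1)) =
    (\<Sum>t | t \<in> A \<and> X t \<noteq> 0. f t)\<^sup>2 - (\<Sum>t | t \<in> A \<and> X t \<noteq> 0. (f t)\<^sup>2)"
proof -
  let ?Z = "{t \<in> A. X t \<noteq> 0}"
  let ?W = "?Z \<times> ?Z - Id"
  define c where "c p = (\<lambda>i\<in>{..<2::nat}. if i = 0 then fst p else snd p)" for p :: "real \<times> real"
  have c: "c p 0 = fst p" "c p 1 = snd p" "c p (Suc 0) = snd p" for p by (auto simp: c_def)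
  have inj: "inj_on c ?W" by (metis (no_types, lifting) c(1,2) inj_onI prod_eqI)
  have "(\<Sum>\<^sub>\<infinity>x\<in>distinct_tuples 2 X. f (x 0) * f (x 1)) = (\<Sum>\<^sub>\<infinity>x\<in>c ` ?W. f (x 0) * f (x 1))"
  proof (rule infsum_cong_neutral)
    fix x assume x: "x \<in> c ` ?W - distinct_tuples 2 X"
    then obtain p where p: "p \<in> ?W" "x = c p" by blast
    have "x \<in> distinct_tuples 2 X"
      using p by (auto simp: distinct_tuples_def c_def inj_on_def less_2_cases_iff)
    then show "f (x 0) * f (x 1) = 0" using x by blast
  next
    fix x assume x: "x \<in> distinct_tuples 2 X - c ` ?W"
    show "f (x 0) * f (x 1) = 0"
    proof (rule ccontr)
      assume "f (x 0) * f (x 1) \<noteq> 0"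
      then have "x 0 \<in> A" "x 1 \<in> A" using z by auto
      moreover have "x 0 \<noteq> x 1" using x inj_onD[of x "{..<2}" 0 1] by (auto simp: distinct_tuples_def)
      ultimately have "(x 0, x 1) \<in> ?W"
        using x by (auto simp: distinct_tuples_def)
      moreover have "x = c (x 0, x 1)"
        using x by (auto simp: distinct_tuples_def c_def fun_eq_iff restrict_def PiE_def extensional_def less_2_cases_iff)
      ultimately show False using x by blast
    qed
  qed simp
  also have "\<dots> = (\<Sum>x\<in>c ` ?W. f (x 0) * f (x 1))" using fin by (intro infsum_finite) auto
  also have "\<dots> = (\<Sum>p\<in>?W. f (fst p) * f (snd p))"
    using inj by (subst sum.reindex) (auto simp: c)
  also have "\<dots> = (\<Sum>p\<in>?Z \<times> ?Z. f (fst p) * f (snd p)) - (\<Sum>p\<in>(\<lambda>t. (t, t)) ` ?Z. f (fst p) * f (snd p))"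
  proof -
    have "?W = ?Z \<times> ?Z - (\<lambda>t. (t, t)) ` ?Z" by auto
    then show ?thesis using fin by (simp only:) (subst sum_diff, auto)
  qed
  also have "(\<Sum>p\<in>(\<lambda>t. (t, t)) ` ?Z. f (fst p) * f (snd p)) = (\<Sum>t\<in>?Z. (f t)\<^sup>2)"
    by (subst sum.reindex) (auto simp: inj_on_def power2_eq_square)
  also have "(\<Sum>p\<in>?Z \<times> ?Z. f (fst p) * f (snd p)) = (\<Sum>t\<in>?Z. f t)\<^sup>2"
    by (simp add: power2_eq_square sum_product sum.cartesian_product case_prod_beta)
  finally show ?thesis .
qed

section \<open>Integrals over products\<close>

lemma (in pair_sigma_finite) integrable_mult_fst_snd:
  fixes f :: "'a \<Rightarrow> 'c :: {real_normed_field, banach, second_countable_topology}" and g :: "'b \<Rightarrow> 'c"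
  assumes "integrable M1 f" "integrable M2 g"
  shows "integrable (M1 \<Otimes>\<^sub>M M2) (\<lambda>p. f (fst p) * g (snd p))"
proof -
  have [measurable]: "f \<in> borel_measurable M1" "g \<in> borel_measurable M2"
    using assms[THEN borel_measurable_integrable] by simp_all
  show ?thesis
    by (rule Fubini_integrable)
      (use assms in \<open>auto simp: norm_mult intro!: integrable_mult_left integrable_mult_right\<close>)
qed

lemma (in pair_sigma_finite) integral_mult_fst_snd:
  fixes f :: "'a \<Rightarrow> 'c :: {real_normed_field, banach, second_countable_topology}" and g :: "'b \<Rightarrow> 'c"
  assumes "integrable M1 f" "integrable M2 g"
  shows "(LINT p|(M1 \<Otimes>\<^sub>M M2). f (fst p) * g (snd p)) = (LINT x|M1. f x) * (LINT x|M2. g x)"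
  using integral_fst'[OF integrable_mult_fst_snd[OF assms]] by simp

interpretation lborel_PiM: product_sigma_finite "\<lambda>_::nat. lborel :: real measure"
  by standard

lemma integral_PiM_1:
  fixes g :: "real \<Rightarrow> complex"
  assumes "g \<in> borel_measurable borel"
  shows "(LINT x|PiM {..<1::nat} (\<lambda>_. lborel). g (x 0)) = (LINT t|lborel. g t)"
proof -
  have "{..<1::nat} = {0}" by auto
  then show ?thesis using lborel_PiM.product_integral_singleton[of g 0] assms by simp
qed

lemma integral_PiM_2:
  fixes g :: "real \<times> real \<Rightarrow> complex"
  assumes int: "integrable (PiM {..<2::nat} (\<lambda>_. lborel)) (\<lambda>x. g (x 0, x 1))"
    and int2: "integrable (lborel \<Otimes>\<^sub>M lborel) g"
  shows "(LINT x|PiM {..<2::nat} (\<lambda>_. lborel). g (x 0, x 1)) = (LINT p|(lborel \<Otimes>\<^sub>M lborel). g p)"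
proof -
  \<comment> \<open>Adjoining coordinate 1 to \<open>{0}\<close> makes its integral the inner one,
    which matches the order of the iterated integral over pairs.\<close>
  have 2: "{..<2::nat} = insert 1 {0}" by auto
  have [measurable]: "g \<in> borel_measurable (lborel \<Otimes>\<^sub>M lborel)" using int2 by simp
  have "(LINT x|PiM {..<2::nat} (\<lambda>_. lborel). g (x 0, x 1)) =
      (LINT x|PiM {0::nat} (\<lambda>_. lborel). LINT t|lborel. g (x 0, t))"
    using int unfolding 2 by (subst lborel_PiM.product_integral_insert) auto
  also have "\<dots> = (LINT s|lborel. LINT t|lborel. g (s, t))"
    by (rule lborel_PiM.product_integral_singleton) measurable
  also have "\<dots> = (LINT p|(lborel \<Otimes>\<^sub>M lborel). g p)"
    using int2 by (rule lborel_pair.integral_fst')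
  finally show ?thesis .
qed

text \<open>The square of the statistic is the sum of \<open>(f t)^2\<close> over the points plus
  the sum over pairs of distinct points, so the one- and two-point identities compute the second
  moment. In the two-point determinant the term \<open>K s s * K t t\<close> yields the squared
  mean, which cancels. \<open>V\<close> is assembled from the integrable tuple sums of these
  identities.\<close>

theorem determinantal_variance:
  fixes f :: "real \<Rightarrow> real" and K :: "real \<Rightarrow> real \<Rightarrow> complex"
  assumes P: "determinantal K P"
    and K [measurable]: "(\<lambda>p. K (fst p) (snd p)) \<in> borel_measurable (lborel \<Otimes>\<^sub>M lborel)"
    and K_le: "\<And>s t. norm (K s t) \<le> 1"
    and f [measurable]: "f \<in> borel_measurable borel"
    and f_nonneg: "\<And>t. 0 \<le> f t" and f_le: "\<And>t. f t \<le> 1"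
    and supp: "\<And>t. \<bar>t\<bar> > R \<Longrightarrow> f t = 0"
  defines "S \<equiv> \<lambda>X. enn2real (\<integral>\<^sup>+t. ennreal (f t) \<partial>config_measure X)"
  obtains c V where "integrable P V" "AE X in P. V X = (S X - c)\<^sup>2"
    "complex_of_real (LINT X|P. V X) = (LINT t|lborel. (f t)\<^sup>2 * K t t) -
       (LINT p|(lborel \<Otimes>\<^sub>M lborel). f (fst p) * f (snd p) * (K (fst p) (snd p) * K (snd p) (fst p)))"
proof -
  let ?A = "{-R..R}"
  have sP: "simple_process P" using P by (simp add: determinantal_def)
  then have spP: "space P = Conf" and prob: "prob_space P" and simple: "AE X in P. \<forall>x. X x \<le> 1"
    by (auto simp: simple_process_def point_process_def)
  interpret prob_space P by (rule prob)
  have Kdiag [measurable]: "(\<lambda>t. K t t) \<in> borel_measurable borel"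
    using measurable_compose[OF _ K, of "\<lambda>t. (t, t)" borel] by simp
  have Kflip [measurable]: "(\<lambda>p. K (snd p) (fst p)) \<in> borel_measurable (lborel \<Otimes>\<^sub>M lborel)"
    using measurable_compose[OF _ K, of "\<lambda>p. (snd p, fst p)" "lborel \<Otimes>\<^sub>M lborel"] by simp
  have z: "t \<notin> ?A \<Longrightarrow> f t = 0" for t by (rule supp) auto
  \<comment> \<open>Stated for a general \<open>g\<close> because it is applied to \<open>f\<close>,
    for the mean, and to the square of \<open>f\<close>, for the diagonal of the second
    moment.\<close>
  have one: "has_bochner_integral P (\<lambda>X. \<Sum>\<^sub>\<infinity>x\<in>distinct_tuples 1 X. complex_of_real (g (x 0)))
      (LINT t|lborel. complex_of_real (g t) * K t t)"
    if [measurable]: "g \<in> borel_measurable borel" and g: "\<And>t. \<bar>g t\<bar> \<le> 1" "\<And>t. t \<notin> ?A \<Longrightarrow> g t = 0"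
    for g :: "real \<Rightarrow> real"
  proof -
    let ?\<phi> = "\<lambda>x :: nat \<Rightarrow> real. complex_of_real (g (x 0))"
    have "?\<phi> \<in> borel_measurable (PiM {..<1} (\<lambda>_. lborel))" by measurable
    moreover have "bounded (?\<phi> ` (\<Pi>\<^sub>E i\<in>{..<1}. UNIV))"
      using g(1) by (auto intro!: boundedI[of _ 1])
    moreover have "\<exists>R. \<forall>x \<in> (\<Pi>\<^sub>E i\<in>{..<1}. UNIV). ?\<phi> x \<noteq> 0 \<longrightarrow> (\<forall>i<1. \<bar>x i\<bar> \<le> R)"
    proof (intro exI[of _ R] ballI impI allI)
      fix x :: "nat \<Rightarrow> real" and i :: nat
      assume "?\<phi> x \<noteq> 0" "i < 1"
      moreover from this have "x 0 \<in> ?A" using g(2)[of "x 0"] by fastforce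
      ultimately show "\<bar>x i\<bar> \<le> R" by (simp add: abs_le_iff)
    qed
    ultimately have "has_bochner_integral P (\<lambda>X. \<Sum>\<^sub>\<infinity>x\<in>distinct_tuples 1 X. ?\<phi> x)
          (LINT x|PiM {..<1} (\<lambda>_. lborel).
             ?\<phi> x * Determinant.det (Matrix.mat 1 1 (\<lambda>(i, j). K (x i) (x j))))"
      using P unfolding determinantal_def by blast
    then show ?thesis
      unfolding det_mat_1 by (subst (asm) integral_PiM_1[of "\<lambda>t. complex_of_real (g t) * K t t"]) simp_all
  qed
  define I2 where "I2 = (LINT p|(lborel \<Otimes>\<^sub>M lborel). f (fst p) * f (snd p) * (K (fst p) (snd p) * K (snd p) (fst p)))"
  define I1 where "I1 = (LINT t|lborel. f t * K t t)"
  have f_int: "integrable lborel f"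
  proof (rule Bochner_Integration.integrable_bound)
    show "integrable lborel (indicator ?A :: real \<Rightarrow> real)"
      by (intro integrable_real_indicator) (auto simp: emeasure_lborel_Icc_eq)
    show "AE x in lborel. norm (f x) \<le> norm (indicator ?A x :: real)"
      using f_nonneg f_le z by (auto simp: indicator_def)
  qed simp
  have ff_int: "integrable (lborel \<Otimes>\<^sub>M lborel) (\<lambda>p. f (fst p) * f (snd p))"
    using f_int f_int by (rule lborel_pair.integrable_mult_fst_snd)
  have int2: "integrable (lborel \<Otimes>\<^sub>M lborel) (\<lambda>p. f (fst p) * f (snd p) * (K (fst p) (snd p) * K (snd p) (fst p)))"
  proof (rule Bochner_Integration.integrable_bound[OF ff_int])
    show "AE p in lborel \<Otimes>\<^sub>M lborel. norm (f (fst p) * f (snd p) * (K (fst p) (snd p) * K (snd p) (fst p)))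
        \<le> norm (f (fst p) * f (snd p))"
      using f_nonneg K_le by (auto simp: norm_mult intro!: mult_left_le mult_nonneg_nonneg mult_le_one)
  qed measurable
  have fK_int: "integrable lborel (\<lambda>t. f t * K t t)"
    by (rule Bochner_Integration.integrable_bound[OF f_int])
      (use f_nonneg K_le in \<open>auto simp: norm_mult intro!: mult_left_le\<close>)
  have int1: "integrable (lborel \<Otimes>\<^sub>M lborel) (\<lambda>p. f (fst p) * K (fst p) (fst p) * (f (snd p) * K (snd p) (snd p)))"
    using fK_int fK_int by (rule lborel_pair.integrable_mult_fst_snd)
  have two: "has_bochner_integral P (\<lambda>X. \<Sum>\<^sub>\<infinity>x\<in>distinct_tuples 2 X. complex_of_real (f (x 0)) * complex_of_real (f (x 1)))
      (I1\<^sup>2 - I2)"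
  proof -
    let ?\<phi> = "\<lambda>x :: nat \<Rightarrow> real. complex_of_real (f (x 0)) * complex_of_real (f (x 1))"
    let ?g = "\<lambda>p. f (fst p) * K (fst p) (fst p) * (f (snd p) * K (snd p) (snd p)) -
       f (fst p) * f (snd p) * (K (fst p) (snd p) * K (snd p) (fst p))"
    have "?\<phi> \<in> borel_measurable (PiM {..<2} (\<lambda>_. lborel))" by measurable
    moreover have "bounded (?\<phi> ` (\<Pi>\<^sub>E i\<in>{..<2}. UNIV))"
      using f_nonneg f_le by (auto simp: norm_mult intro!: boundedI[of _ 1] mult_le_one)
    moreover have "\<exists>R. \<forall>x \<in> (\<Pi>\<^sub>E i\<in>{..<2}. UNIV). ?\<phi> x \<noteq> 0 \<longrightarrow> (\<forall>i<2. \<bar>x i\<bar> \<le> R)"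
    proof (intro exI[of _ R] ballI impI allI)
      fix x :: "nat \<Rightarrow> real" and i :: nat
      assume "?\<phi> x \<noteq> 0" "i < 2"
      moreover from this have "i = 0 \<or> i = 1" by (simp add: less_2_cases_iff)
      ultimately show "\<bar>x i\<bar> \<le> R"
        using supp[of "x 0"] supp[of "x 1"] by (fastforce simp: not_le[symmetric])
    qed
    ultimately have "integrable (PiM {..<2} (\<lambda>_. lborel))
          (\<lambda>x. ?\<phi> x * Determinant.det (Matrix.mat 2 2 (\<lambda>(i, j). K (x i) (x j))))"
       "has_bochner_integral P (\<lambda>X. \<Sum>\<^sub>\<infinity>x\<in>distinct_tuples 2 X. ?\<phi> x)
          (LINT x|PiM {..<2} (\<lambda>_. lborel).
             ?\<phi> x * Determinant.det (Matrix.mat 2 2 (\<lambda>(i, j). K (x i) (x j))))"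
      using P unfolding determinantal_def by (meson one_le_numeral)+
    moreover have "?\<phi> x * Determinant.det (Matrix.mat 2 2 (\<lambda>(i, j). K (x i) (x j))) = ?g (x 0, x 1)" for x
      unfolding det_mat_2 by (simp add: algebra_simps)
    ultimately have h0: "integrable (PiM {..<2} (\<lambda>_. lborel)) (\<lambda>x::nat\<Rightarrow>real. ?g (x 0, x 1))"
      and h: "has_bochner_integral P (\<lambda>X. \<Sum>\<^sub>\<infinity>x\<in>distinct_tuples 2 X. ?\<phi> x)
          (LINT x|PiM {..<2::nat} (\<lambda>_. lborel). ?g (x 0, x 1))" by simp_all
    have "(LINT x|PiM {..<2::nat} (\<lambda>_. lborel). ?g (x 0, x 1)) = (LINT p|(lborel \<Otimes>\<^sub>M lborel). ?g p)"
      using h0 Bochner_Integration.integrable_diff[OF int1 int2] by (rule integral_PiM_2[where g="?g"])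
    also have "\<dots> = I1\<^sup>2 - I2"
      unfolding I1_def I2_def power2_eq_square lborel_pair.integral_mult_fst_snd[OF fK_int fK_int, symmetric]
      by (rule Bochner_Integration.integral_diff[OF int1 int2])
    finally show ?thesis using h by simp
  qed
  \<comment> \<open>\<open>Q1\<close> is the statistic, \<open>Q2\<close> the diagonal and
    \<open>Q3\<close> the off-diagonal part of its square. They are complex sums over tuples and are
    identified with finite real sums almost surely.\<close>
  define Q1 where "Q1 X = (\<Sum>\<^sub>\<infinity>x\<in>distinct_tuples 1 X. complex_of_real (f (x 0)))" for X
  define Q2 where "Q2 X = (\<Sum>\<^sub>\<infinity>x\<in>distinct_tuples 1 X. complex_of_real ((f (x 0))\<^sup>2))" for X
  define Q3 where "Q3 X = (\<Sum>\<^sub>\<infinity>x\<in>distinct_tuples 2 X. complex_of_real (f (x 0)) * complex_of_real (f (x 1)))" for X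
  have h1: "has_bochner_integral P Q1 I1"
    unfolding Q1_def I1_def using f_nonneg f_le z by (intro one) auto
  have h2: "has_bochner_integral P Q2 (LINT t|lborel. (f t)\<^sup>2 * K t t)" (is "has_bochner_integral _ _ ?I3")
    unfolding Q2_def using f_nonneg f_le z by (intro one) (auto simp: power_le_one)
  have h3: "has_bochner_integral P Q3 (I1\<^sup>2 - I2)"
    unfolding Q3_def by (rule two)
  have ae: "AE X in P. Q1 X = complex_of_real (S X) \<and> Q2 X + Q3 X = complex_of_real ((S X)\<^sup>2)"
    using simple AE_space
  proof eventually_elim
    case (elim X)
    then have fin: "finite {t \<in> ?A. X t \<noteq> 0}" using spP by (intro finite_Conf) auto
    have S: "S X = (\<Sum>t | t \<in> ?A \<and> X t \<noteq> 0. f t)"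
      unfolding S_def using fin elim(1) f_nonneg z
      by (subst nn_integral_config[where A="?A"]) (auto simp: sum_nonneg)
    have "Q1 X = complex_of_real (S X)"
      unfolding Q1_def S using fin z by (subst infsum_distinct_tuples_1[where A="?A" and f="\<lambda>t. complex_of_real (f t)"]) auto
    moreover have "Q2 X = complex_of_real (\<Sum>t | t \<in> ?A \<and> X t \<noteq> 0. (f t)\<^sup>2)"
      unfolding Q2_def using fin z by (subst infsum_distinct_tuples_1[where A="?A" and f="\<lambda>t. complex_of_real ((f t)\<^sup>2)"]) auto
    moreover have "Q3 X = complex_of_real ((S X)\<^sup>2 - (\<Sum>t | t \<in> ?A \<and> X t \<noteq> 0. (f t)\<^sup>2))"
      unfolding Q3_def S using fin z by (subst infsum_distinct_tuples_2[where A="?A" and f="\<lambda>t. complex_of_real (f t)"]) auto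
    ultimately show ?case by simp
  qed
  define c where "c = Re I1"
  \<comment> \<open>The mean is real as the expectation of \<open>Q1\<close>, which is real almost
    surely.\<close>
  have I1: "I1 = complex_of_real c"
  proof -
    have "Im I1 = (LINT X|P. Im (Q1 X))"
      using h1 integral_Im[of P Q1] by (auto simp: has_bochner_integral_iff)
    also have "\<dots> = (LINT X|P. 0)"
    proof (rule integral_cong_AE)
      show "AE X in P. Im (Q1 X) = 0" using ae by eventually_elim simp
    qed (use h1 in \<open>auto simp: has_bochner_integral_iff\<close>)
    finally show ?thesis by (simp add: c_def complex_eq_iff)
  qed
  have "has_bochner_integral P (\<lambda>X. Q2 X + Q3 X - (2 * c) * Q1 X + c\<^sup>2) (?I3 + (I1\<^sup>2 - I2) - (2 * c) * I1 + c\<^sup>2)"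
  proof -
    have "has_bochner_integral P (\<lambda>X. complex_of_real (c\<^sup>2)) (complex_of_real (c\<^sup>2))"
      by (simp add: has_bochner_integral_iff prob_space)
    then show ?thesis 
      by (intro has_bochner_integral_add has_bochner_integral_diff h1 h2 h3 has_bochner_integral_mult_right) auto
  qed
  \<comment> \<open>With \<open>I1 = c\<close>, the terms \<open>I1^2 - 2 * c * I1 + c^2\<close>
    vanish.\<close>
  also have "?I3 + (I1\<^sup>2 - I2) - (2 * c) * I1 + c\<^sup>2 = ?I3 - I2"
    by (simp add: I1 power2_eq_square)
  finally have h: "has_bochner_integral P (\<lambda>X. Q2 X + Q3 X - (2 * c) * Q1 X + c\<^sup>2) (?I3 - I2)" .
  define W where "W X = Q2 X + Q3 X - (2 * c) * Q1 X + c\<^sup>2" for X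
  have W: "has_bochner_integral P W (?I3 - I2)" using h by (simp add: W_def[abs_def])
  have aeW: "AE X in P. W X = complex_of_real ((S X - c)\<^sup>2)"
    using ae by eventually_elim (simp add: W_def power2_diff)
  have "integrable P (\<lambda>X. Re (W X))"
    using W by (simp add: has_bochner_integral_iff)
  moreover have "AE X in P. Re (W X) = (S X - c)\<^sup>2"
    using aeW by eventually_elim simp
  moreover have "complex_of_real (LINT X|P. Re (W X)) = ?I3 - I2"
  proof -
    have "complex_of_real (LINT X|P. Re (W X)) = (LINT X|P. complex_of_real (Re (W X)))"
      by simp
    also have "\<dots> = (LINT X|P. W X)"
    proof (rule integral_cong_AE)
      show "AE X in P. complex_of_real (Re (W X)) = W X" using aeW by eventually_elim simp
    qed (use W in \<open>auto simp: has_bochner_integral_iff\<close>)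
    also have "\<dots> = ?I3 - I2" using W by (simp add: has_bochner_integral_iff)
    finally show ?thesis .
  qed
  ultimately show ?thesis using that[of "\<lambda>X. Re (W X)" c] unfolding I2_def by blast
qed

section \<open>Gaussian test functions\<close>

lemma borel_measurable_cis [measurable]: "cis \<in> borel_measurable borel"
  by (intro borel_measurable_continuous_onI continuous_intros)

lemma fourier_kernel_cis:
  "fourier_kernel M s t = (LINT x|lborel. indicator M x * cis (-2 * pi * x * (s - t)))"
  unfolding fourier_kernel_def fourier_def cis_conv_exp
  by (intro Bochner_Integration.integral_cong refl) (simp add: mult_ac)

lemma integrable_indicator_cis:
  fixes M :: "real set"
  assumes [measurable]: "M \<in> sets borel" and "M \<subseteq> {0..1}" and [measurable]: "g \<in> borel_measurable borel"
  shows "integrable lborel (\<lambda>x. indicator M x * cis (g x))"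
proof (rule Bochner_Integration.integrable_bound)
  show "integrable lborel (indicator {0..1::real} :: real \<Rightarrow> real)" 
    by (intro integrable_real_indicator) auto
  show "AE x in lborel. norm (indicator M x * cis (g x)) \<le> norm (indicator {0..1} x :: real)"
    using assms(2) by (auto simp: norm_mult indicator_def intro!: AE_I2)
qed measurable

lemma fourier_kernel_norm:
  assumes [measurable]: "M \<in> sets borel" and M: "M \<subseteq> {0..1}"
  shows "norm (fourier_kernel M s t) \<le> 1"
proof -
  have "norm (fourier_kernel M s t) \<le> (LINT x|lborel. norm (indicator M x * cis (-2 * pi * x * (s - t))))"
    unfolding fourier_kernel_cis by (rule integral_norm_bound)
  also have "\<dots> \<le> (LINT x|lborel. indicator {0..1::real} x)"
  proof (rule integral_mono)
    show "integrable lborel (\<lambda>x. norm (indicator M x * cis (-2 * pi * x * (s - t))))"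
      using M by (intro integrable_norm integrable_indicator_cis) auto
    show "integrable lborel (indicator {0..1::real} :: real \<Rightarrow> real)"
      by (intro integrable_real_indicator) auto
    show "norm (indicator M x * cis (-2 * pi * x * (s - t))) \<le> indicator {0..1} x" for x
      using M by (auto simp: norm_mult indicator_def)
  qed
  finally show ?thesis by simp
qed

lemma fourier_kernel_diag: "M \<in> sets borel \<Longrightarrow> fourier_kernel M t t = complex_of_real (measure lborel M)"
proof -
  assume [measurable]: "M \<in> sets borel"
  have "fourier_kernel M t t = (LINT x|lborel. complex_of_real (indicator M x))"
    unfolding fourier_kernel_cis by (intro Bochner_Integration.integral_cong refl) (simp add: indicator_def)
  then show ?thesis by simp
qed

lemma fourier_kernel_measurable:
  assumes [measurable]: "M \<in> sets borel"
  shows "(\<lambda>p. fourier_kernel M (fst p) (snd p)) \<in> borel_measurable (lborel \<Otimes>\<^sub>M lborel)"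
  unfolding fourier_kernel_cis by measurable

text \<open>Normalised so that the integral is \<open>L\<close> and the Fourier transform, with the
  factor \<open>2 * pi\<close> in the phase, is \<open>L * gauss (1 / L)\<close>.\<close>

definition gauss :: "real \<Rightarrow> real \<Rightarrow> real" where
  "gauss L x = exp (- pi * x\<^sup>2 / L\<^sup>2)"

lemma gauss_measurable [measurable]: "gauss L \<in> borel_measurable borel"
  unfolding gauss_def by measurable

lemma gauss_pos: "0 < gauss L x" and gauss_le_1: "gauss L x \<le> 1"
  by (simp_all add: gauss_def)

lemma gauss_normal_density: "L > 0 \<Longrightarrow> gauss L x = L * normal_density 0 (L / sqrt (2 * pi)) x"
  by (simp add: gauss_def normal_density_def power_divide real_sqrt_divide)

lemma gauss_integrable: "L > 0 \<Longrightarrow> integrable lborel (gauss L)"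
  and gauss_integral: "L > 0 \<Longrightarrow> (LINT x|lborel. gauss L x) = L"
  and gauss_abs_integrable: "L > 0 \<Longrightarrow> integrable lborel (\<lambda>x. gauss L x * \<bar>x\<bar>)"
  and gauss_abs_integral: "L > 0 \<Longrightarrow> (LINT x|lborel. gauss L x * \<bar>x\<bar>) = L\<^sup>2 / pi"
proof -
  assume L: "L > 0"
  define \<sigma> where "\<sigma> = L / sqrt (2 * pi)"
  have \<sigma>: "\<sigma> > 0" using L by (simp add: \<sigma>_def)
  have g: "gauss L = (\<lambda>x. L * normal_density 0 \<sigma> x)"
    using L by (auto simp: gauss_normal_density \<sigma>_def)
  show "integrable lborel (gauss L)" unfolding g using \<sigma> by simp
  show "(LINT x|lborel. gauss L x) = L" unfolding g using \<sigma> by simp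
  show "integrable lborel (\<lambda>x. gauss L x * \<bar>x\<bar>)"
    unfolding g mult.assoc using integrable_normal_moment_abs[OF \<sigma>, of 0 1] by simp
  \<comment> \<open>A centred normal law with standard deviation \<open>\<sigma>\<close> has first
    absolute moment \<open>\<sigma> * sqrt (2 / pi)\<close>.\<close>
  have "(LINT x|lborel. gauss L x * \<bar>x\<bar>) = L * (\<sigma> * sqrt (2 / pi))"
    unfolding g mult.assoc using integral_normal_moment_abs_odd[OF \<sigma>, of 0 0] by simp
  also have "\<dots> = L\<^sup>2 / pi"
    by (simp add: \<sigma>_def real_sqrt_divide real_sqrt_mult power2_eq_square)
  finally show "(LINT x|lborel. gauss L x * \<bar>x\<bar>) = L\<^sup>2 / pi" .
qed

text \<open>This is the characteristic function of the standard normal law after substituting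
  \<open>c * x\<close> for \<open>x\<close>: \<open>c\<close> turns the density into a multiple of
  \<open>gauss L\<close>, and \<open>t\<close> satisfies
  \<open>t * c = - 2 * pi * \<xi>\<close>.\<close>

lemma gauss_fourier:
  assumes L: "L > 0"
  shows "(LINT x|lborel. gauss L x * cis (-2 * pi * x * \<xi>)) = complex_of_real (L * gauss (1 / L) \<xi>)"
proof -
  define t where "t = - sqrt (2 * pi) * L * \<xi>"
  define c where "c = sqrt (2 * pi) / L"
  have c: "c > 0" using L by (simp add: c_def)
  have "complex_of_real (exp (- (t\<^sup>2) / 2)) = char std_normal_distribution t"
    by (simp add: char_std_normal_distribution)
  also have "\<dots> = (LINT x|lborel. std_normal_density x *\<^sub>R cis (t * x))"
    unfolding char_def cis_conv_exp by (subst integral_density) auto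
  also have "\<dots> = \<bar>c\<bar> *\<^sub>R (LINT x|lborel. std_normal_density (0 + c * x) *\<^sub>R cis (t * (0 + c * x)))"
    using c by (intro lborel_integral_real_affine) simp
  also have "(\<lambda>x. std_normal_density (0 + c * x) *\<^sub>R cis (t * (0 + c * x))) =
      (\<lambda>x. (1 / sqrt (2 * pi)) *\<^sub>R (gauss L x * cis (-2 * pi * x * \<xi>)))"
  proof
    fix x
    have "(c * x)\<^sup>2 / 2 = pi * x\<^sup>2 / L\<^sup>2" using L by (simp add: c_def power_mult_distrib power_divide)
    moreover have "t * (c * x) = -2 * pi * x * \<xi>"
      using L by (simp add: t_def c_def)
    ultimately show "std_normal_density (0 + c * x) *\<^sub>R cis (t * (0 + c * x)) =
        (1 / sqrt (2 * pi)) *\<^sub>R (gauss L x * cis (-2 * pi * x * \<xi>))"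
      by (simp add: std_normal_density_def gauss_def scaleR_conv_of_real)
  qed
  also have "\<bar>c\<bar> *\<^sub>R (LINT x|lborel. (1 / sqrt (2 * pi)) *\<^sub>R (gauss L x * cis (-2 * pi * x * \<xi>))) =
      (1 / L) *\<^sub>R (LINT x|lborel. gauss L x * cis (-2 * pi * x * \<xi>))"
    using c L by (simp add: c_def)
  finally have "(LINT x|lborel. gauss L x * cis (-2 * pi * x * \<xi>)) = L *\<^sub>R complex_of_real (exp (- (t\<^sup>2) / 2))"
    using L by simp
  also have "exp (- (t\<^sup>2) / 2) = gauss (1 / L) \<xi>"
    by (simp add: t_def gauss_def power_mult_distrib power_divide)
  finally show ?thesis by (simp add: scaleR_conv_of_real)
qed

text \<open>Exponents add. Both products involve the same \<open>sqrt (L^2 + L'^2)\<close>, which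
  later lets the position and the frequency term of a pair of scales be compared.\<close>

lemma gauss_mult: 
  assumes "L > 0" "L' > 0"
  shows "gauss L x * gauss L' x = gauss (L * L' / sqrt (L\<^sup>2 + L'\<^sup>2)) x"
    "gauss (1 / L) x * gauss (1 / L') x = gauss (1 / sqrt (L\<^sup>2 + L'\<^sup>2)) x"
proof -
  have "L\<^sup>2 + L'\<^sup>2 > 0" using assms by (simp add: add_pos_pos)
  then show "gauss L x * gauss L' x = gauss (L * L' / sqrt (L\<^sup>2 + L'\<^sup>2)) x"
    "gauss (1 / L) x * gauss (1 / L') x = gauss (1 / sqrt (L\<^sup>2 + L'\<^sup>2)) x"
    using assms by (simp_all add: gauss_def power_divide power_mult_distrib flip: exp_add)
      (simp_all add: field_simps)
qed

section \<open>The variance as an energy on the frequency side\<close>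

interpretation lborel_pair_pair: pair_sigma_finite
  "lborel \<Otimes>\<^sub>M lborel :: (real \<times> real) measure" "lborel \<Otimes>\<^sub>M lborel :: (real \<times> real) measure"
  unfolding lborel_prod by standard

text \<open>Each kernel is an integral over \<open>M\<close>, so the left side is an integral over
  two positions and two frequencies. Integrating out the positions first leaves
  \<open>H (x - y) * H (y - x)\<close> for frequencies \<open>x\<close>, \<open>y\<close> in
  \<open>M\<close>, and evenness makes this a square.\<close>

lemma kernel_energy_fourier:
  fixes F H :: "real \<Rightarrow> real"
  assumes [measurable]: "M \<in> sets borel" and M: "M \<subseteq> {0..1}"
    and F: "integrable lborel F"
    and H: "\<And>\<xi>. (LINT x|lborel. F x * cis (-2 * pi * x * \<xi>)) = complex_of_real (H \<xi>)"
    and even: "\<And>\<xi>. H (- \<xi>) = H \<xi>"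
  shows "(LINT p|(lborel \<Otimes>\<^sub>M lborel). F (fst p) * F (snd p) *
       (fourier_kernel M (fst p) (snd p) * fourier_kernel M (snd p) (fst p))) =
     complex_of_real (LINT q|(lborel \<Otimes>\<^sub>M lborel). indicator M (fst q) * indicator M (snd q) * (H (fst q - snd q))\<^sup>2)"
proof -
  have [measurable]: "F \<in> borel_measurable borel" using F by simp
  have cF: "integrable lborel (\<lambda>x. complex_of_real (F x))" using F by simp
  have cM: "integrable lborel (\<lambda>x. indicator M x :: complex)"
    using integrable_indicator_cis[OF assms(1,2), of "\<lambda>_. 0"] by simp
  have Fcis: "integrable lborel (\<lambda>x. F x * cis (g x))" if [measurable]: "g \<in> borel_measurable borel" for g
    by (rule Bochner_Integration.integrable_bound[OF F]) (auto simp: norm_mult)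
  define G :: "real \<times> real \<Rightarrow> real \<times> real \<Rightarrow> complex" where
    "G p q = F (fst p) * F (snd p) * (indicator M (fst q) * indicator M (snd q) :: complex) *
       cis (-2 * pi * (fst p - snd p) * (fst q - snd q))" for p q
  \<comment> \<open>The phase in \<open>G\<close> has modulus 1, so this product dominates
    \<open>G\<close> and Fubini applies.\<close>
  have "integrable ((lborel \<Otimes>\<^sub>M lborel) \<Otimes>\<^sub>M (lborel \<Otimes>\<^sub>M lborel))
     (\<lambda>pq. (complex_of_real (F (fst (fst pq))) * complex_of_real (F (snd (fst pq)))) *
        (indicator M (fst (snd pq)) * indicator M (snd (snd pq))))"
    by (intro lborel_pair_pair.integrable_mult_fst_snd lborel_pair.integrable_mult_fst_snd cF cM)
  then have G_int: "integrable ((lborel \<Otimes>\<^sub>M lborel) \<Otimes>\<^sub>M (lborel \<Otimes>\<^sub>M lborel)) (case_prod G)"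
  proof (rule Bochner_Integration.integrable_bound)
    show "case_prod G \<in> borel_measurable ((lborel \<Otimes>\<^sub>M lborel) \<Otimes>\<^sub>M (lborel \<Otimes>\<^sub>M lborel))"
      unfolding G_def by measurable
  qed (auto simp: G_def norm_mult case_prod_beta indicator_def)
  have "(LINT q|(lborel \<Otimes>\<^sub>M lborel). G p q) = F (fst p) * F (snd p) *
      (fourier_kernel M (fst p) (snd p) * fourier_kernel M (snd p) (fst p))" for p
  proof -
    have "(LINT q|(lborel \<Otimes>\<^sub>M lborel). G p q) = (LINT q|(lborel \<Otimes>\<^sub>M lborel). F (fst p) * F (snd p) *
       ((indicator M (fst q) * cis (-2 * pi * fst q * (fst p - snd p))) *
        (indicator M (snd q) * cis (-2 * pi * snd q * (snd p - fst p)))))"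
    proof (rule Bochner_Integration.integral_cong[OF refl])
      fix q :: "real \<times> real"
      have "cis (-2 * pi * (fst p - snd p) * (fst q - snd q)) =
          cis (-2 * pi * fst q * (fst p - snd p)) * cis (-2 * pi * snd q * (snd p - fst p))"
        unfolding cis_mult by (simp add: algebra_simps)
      then show "G p q = F (fst p) * F (snd p) *
         ((indicator M (fst q) * cis (-2 * pi * fst q * (fst p - snd p))) *
          (indicator M (snd q) * cis (-2 * pi * snd q * (snd p - fst p))))"
        by (simp add: G_def)
    qed
    also have "\<dots> = F (fst p) * F (snd p) *
      (fourier_kernel M (fst p) (snd p) * fourier_kernel M (snd p) (fst p))"
      unfolding fourier_kernel_cis
      by (subst integral_mult_right_zero, subst lborel_pair.integral_mult_fst_snd)
        (use M in \<open>auto intro!: integrable_indicator_cis\<close>)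
    finally show ?thesis .
  qed
  moreover have "(LINT p|(lborel \<Otimes>\<^sub>M lborel). G p q) =
      complex_of_real (indicator M (fst q) * indicator M (snd q) * (H (fst q - snd q))\<^sup>2)" for q
  proof -
    have "(LINT p|(lborel \<Otimes>\<^sub>M lborel). G p q) = (LINT p|(lborel \<Otimes>\<^sub>M lborel). (indicator M (fst q) * indicator M (snd q) :: complex) *
       ((F (fst p) * cis (-2 * pi * fst p * (fst q - snd q))) *
        (F (snd p) * cis (-2 * pi * snd p * - (fst q - snd q)))))"
    proof (rule Bochner_Integration.integral_cong[OF refl])
      fix p :: "real \<times> real"
      have "cis (-2 * pi * (fst p - snd p) * (fst q - snd q)) =
          cis (-2 * pi * fst p * (fst q - snd q)) * cis (-2 * pi * snd p * - (fst q - snd q))"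
        unfolding cis_mult by (simp add: algebra_simps)
      then show "G p q = (indicator M (fst q) * indicator M (snd q) :: complex) *
       ((F (fst p) * cis (-2 * pi * fst p * (fst q - snd q))) *
        (F (snd p) * cis (-2 * pi * snd p * - (fst q - snd q))))"
        by (simp add: G_def)
    qed
    also have "\<dots> = (indicator M (fst q) * indicator M (snd q) :: complex) * (H (fst q - snd q) * H (- (fst q - snd q)))"
      by (subst integral_mult_right_zero, subst lborel_pair.integral_mult_fst_snd)
        (auto simp only: H of_real_mult intro!: Fcis, measurable)
    also have "\<dots> = complex_of_real (indicator M (fst q) * indicator M (snd q) * (H (fst q - snd q))\<^sup>2)"
      unfolding even by (simp add: power2_eq_square indicator_def)
    finally show ?thesis .
  qed
  ultimately show ?thesis
    using lborel_pair_pair.Fubini_integral[OF G_int] by (simp only: integral_complex_of_real)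
qed

text \<open>After the substitution \<open>u = s - t\<close>, integrating over \<open>s\<close> first
  gives \<open>measure lborel M - shift_defect M u\<close> against \<open>h\<close>. Hence the left
  side is the integral of \<open>shift_defect M u * h u\<close>, and the pointwise bound can be
  integrated.\<close>

lemma defect_bound:
  fixes h :: "real \<Rightarrow> real"
  assumes [measurable]: "M \<in> sets borel" and M: "M \<subseteq> {0..1}"
    and defect: "\<And>u. shift_defect M u \<le> A * \<bar>u\<bar> + \<delta>"
    and h: "integrable lborel h" and h_abs: "integrable lborel (\<lambda>u. h u * \<bar>u\<bar>)"
    and h_nonneg: "\<And>u. 0 \<le> h u" and h_le: "\<And>u. h u \<le> 1"
  shows "measure lborel M * (LINT u|lborel. h u) -
      (LINT q|(lborel \<Otimes>\<^sub>M lborel). indicator M (fst q) * indicator M (snd q) * h (fst q - snd q))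
    \<le> A * (LINT u|lborel. h u * \<bar>u\<bar>) + \<delta> * (LINT u|lborel. h u)"
proof -
  have [measurable]: "h \<in> borel_measurable borel" using h by simp
  have eM: "emeasure lborel M < \<infinity>"
    using emeasure_mono[OF M, of lborel] by (auto intro: le_less_trans)
  have iM: "integrable lborel (indicator M :: real \<Rightarrow> real)"
    using eM by (intro integrable_real_indicator) auto
  have i1: "integrable (lborel \<Otimes>\<^sub>M lborel) (\<lambda>q. indicator M (fst q) * indicator M (snd q) * h (fst q - snd q))"
    by (rule Bochner_Integration.integrable_bound[OF lborel_pair.integrable_mult_fst_snd[OF iM iM]])
      (use h_nonneg h_le in \<open>auto simp: indicator_def\<close>)
  have i2: "integrable (lborel \<Otimes>\<^sub>M lborel) (\<lambda>(s, u). indicator M s * indicator M (s - u) * h u)"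
    by (rule Bochner_Integration.integrable_bound[OF lborel_pair.integrable_mult_fst_snd[OF iM h]])
      (use h_nonneg in \<open>auto simp: indicator_def\<close>)
  have defect': "(LINT s|lborel. indicator M s * indicator M (s - u)) = measure lborel M - shift_defect M u" for u
  proof -
    have sub: "{s \<in> M. s - u \<notin> M} \<subseteq> M" by auto
    have [measurable]: "{s \<in> M. s - u \<notin> M} \<in> sets borel" by measurable
    have "(LINT s|lborel. indicator M s * indicator M (s - u)) = (LINT s|lborel. indicator (M - {s \<in> M. s - u \<notin> M}) s :: real)"
      by (intro Bochner_Integration.integral_cong) (auto simp: indicator_def)
    also have "\<dots> = measure lborel (M - {s \<in> M. s - u \<notin> M})" by simp
    also have "\<dots> = measure lborel M - shift_defect M u"
      unfolding shift_defect_def using sub eM by (intro measure_Diff) auto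
    finally show ?thesis .
  qed
  have "(LINT q|(lborel \<Otimes>\<^sub>M lborel). indicator M (fst q) * indicator M (snd q) * h (fst q - snd q)) =
      (LINT s|lborel. LINT t|lborel. indicator M s * indicator M t * h (s - t))"
    using lborel_pair.integral_fst'[OF i1] by simp
  also have "\<dots> = (LINT s|lborel. LINT u|lborel. indicator M s * indicator M (s - u) * h u)"
  proof (rule Bochner_Integration.integral_cong[OF refl])
    fix s :: real
    show "(LINT t|lborel. indicator M s * indicator M t * h (s - t)) =
        (LINT u|lborel. indicator M s * indicator M (s - u) * h u)"
      by (subst lborel_integral_real_affine[where c="-1" and t=s]) auto
  qed
  also have "\<dots> = (LINT u|lborel. LINT s|lborel. indicator M s * indicator M (s - u) * h u)"
    using lborel_pair.Fubini_integral[OF i2] by simp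
  also have "\<dots> = (LINT u|lborel. (measure lborel M - shift_defect M u) * h u)"
    by (simp add: defect')
  finally have eq: "(LINT q|(lborel \<Otimes>\<^sub>M lborel). indicator M (fst q) * indicator M (snd q) * h (fst q - snd q)) =
     (LINT u|lborel. (measure lborel M - shift_defect M u) * h u)" .
  \<comment> \<open>Integrability in \<open>u\<close> comes from Fubini, as this is the inner
    integral over \<open>s\<close> computed in \<open>defect'\<close>.\<close>
  have i3: "integrable lborel (\<lambda>u. (measure lborel M - shift_defect M u) * h u)"
    using lborel_pair.integrable_snd[OF i2] by (simp add: defect')
  have "measure lborel M * (LINT u|lborel. h u) - (LINT u|lborel. (measure lborel M - shift_defect M u) * h u) =
     (LINT u|lborel. measure lborel M * h u - (measure lborel M - shift_defect M u) * h u)"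
    using h i3 by simp
  also have "\<dots> \<le> (LINT u|lborel. A * (h u * \<bar>u\<bar>) + \<delta> * h u)"
  proof (rule integral_mono)
    show "integrable lborel (\<lambda>u. measure lborel M * h u - (measure lborel M - shift_defect M u) * h u)"
      using h i3 by simp
    show "integrable lborel (\<lambda>u. A * (h u * \<bar>u\<bar>) + \<delta> * h u)" using h h_abs by simp
    show "measure lborel M * h u - (measure lborel M - shift_defect M u) * h u \<le> A * (h u * \<bar>u\<bar>) + \<delta> * h u" for u
      using mult_right_mono[OF defect[of u] h_nonneg[of u]] by (simp add: algebra_simps)
  qed
  also have "\<dots> = A * (LINT u|lborel. h u * \<bar>u\<bar>) + \<delta> * (LINT u|lborel. h u)"
    using h h_abs by simp
  finally show ?thesis by (simp add: eq)
qed

section \<open>Averaging over dyadic scales\<close>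

text \<open>Truncated subtraction makes one exponent 0, so the summand is \<open>1/2\<close> to the
  power of the distance between \<open>i\<close> and \<open>j\<close>, and either side of
  \<open>i\<close> contributes at most 2. The bounds \<open>low\<close> and \<open>high\<close>
  carry a geometric remainder so that the inductions close.\<close>

lemma two_sided_geometric_sum_le:
  "(\<Sum>j<K. (1/2::real) ^ (i - j) * (1/2) ^ (j - i)) \<le> 4"
proof -
  let ?s = "\<lambda>K. \<Sum>j<K. (1/2::real) ^ (i - j) * (1/2) ^ (j - i)"
  have low: "?s K \<le> 2 * (1/2) ^ (Suc i - K)" if "K \<le> Suc i" for K
    using that
  proof (induction K)
    case (Suc K)
    then have "Suc i - K = Suc (i - K)" by simp
    then show ?case using Suc by simp
  qed simp
  have high: "?s (Suc i + d) \<le> 4 - 2 * (1/2) ^ d" for d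
  proof (induction d)
    case 0
    then show ?case using low[of "Suc i"] by simp
  next
    case (Suc d)
    have "?s (Suc i + Suc d) = ?s (Suc i + d) + (1/2) ^ Suc d" by simp
    moreover have "(1/2::real) ^ Suc d = (1/2) ^ d / 2" "0 \<le> (1/2::real) ^ d" by simp_all
    ultimately show ?case using Suc by linarith
  qed
  show ?thesis
  proof (cases "K \<le> Suc i")
    case True
    have "?s K \<le> 2 * (1/2) ^ (Suc i - K)" using low True by blast
    also have "\<dots> \<le> 2 * 1" by (intro mult_left_mono power_le_one) auto
    finally show ?thesis by simp
  next
    case False
    then obtain d where "K = Suc i + d" by (metis le_add_diff_inverse nat_le_linear)
    then show ?thesis using high[of d] by (smt (verit) zero_le_power divide_nonneg_pos)
  qed
qed

text \<open>Dropping the smaller square from the denominator leaves the ratio of the smaller scale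
  to the larger; this is the near orthogonality of distant scales. The second bound keeps only
  \<open>b^2\<close> under the root.\<close>

lemma dyadic_product_bounds:
  fixes n i j :: nat
  defines "a \<equiv> (2::real) ^ (n + i)" and "b \<equiv> (2::real) ^ (n + j)"
  shows "a * b / (a\<^sup>2 + b\<^sup>2) \<le> (1/2) ^ (i - j) * (1/2) ^ (j - i)"
    "a * b / sqrt (a\<^sup>2 + b\<^sup>2) \<le> a"
proof -
  have ab: "a > 0" "b > 0" by (simp_all add: a_def b_def)
  have *: "2 ^ (n + k) * 2 ^ (n + (k + d)) / ((2 ^ (n + k))\<^sup>2 + (2 ^ (n + (k + d)))\<^sup>2) \<le> (1/2 :: real) ^ d" for k d
  proof -
    let ?x = "(2::real) ^ (n + k)" and ?y = "(2::real) ^ d"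
    have "2 ^ (n + k) * 2 ^ (n + (k + d)) / ((2 ^ (n + k))\<^sup>2 + (2 ^ (n + (k + d)))\<^sup>2)
        = (?x * (?x * ?y)) / (?x\<^sup>2 + (?x * ?y)\<^sup>2)"
      by (simp add: power_add mult_ac)
    also have "\<dots> \<le> (?x * (?x * ?y)) / (?x * ?y)\<^sup>2"
      by (intro divide_left_mono mult_pos_pos add_pos_pos) auto
    also have "\<dots> = (1/2) ^ d"
      by (simp add: power2_eq_square power_one_over field_simps)
    finally show ?thesis .
  qed
  show "a * b / (a\<^sup>2 + b\<^sup>2) \<le> (1/2) ^ (i - j) * (1/2) ^ (j - i)"
  proof (cases "i \<le> j")
    case True
    then obtain d where "j = i + d" using le_Suc_ex by blast
    then show ?thesis using *[of i d] by (simp add: a_def b_def)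
  next
    case False
    then obtain d where "i = j + d" using le_Suc_ex nat_le_linear by blast
    then show ?thesis using *[of j d] by (simp add: a_def b_def mult.commute add.commute)
  qed
  have "b \<le> sqrt (a\<^sup>2 + b\<^sup>2)" by (rule real_le_rsqrt) simp
  then show "a * b / sqrt (a\<^sup>2 + b\<^sup>2) \<le> a"
    using ab by (simp add: divide_le_eq mult_left_mono add_pos_pos)
qed

definition gauss_avg :: "nat \<Rightarrow> (nat \<Rightarrow> real) \<Rightarrow> real \<Rightarrow> real" where
  "gauss_avg K L x = (\<Sum>i<K. gauss (L i) x) / K"

definition gauss_avg_fourier :: "nat \<Rightarrow> (nat \<Rightarrow> real) \<Rightarrow> real \<Rightarrow> real" where
  "gauss_avg_fourier K L \<xi> = (\<Sum>i<K. L i * gauss (1 / L i) \<xi>) / K"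

lemma gauss_avg_measurable [measurable]: "gauss_avg K L \<in> borel_measurable borel"
  unfolding gauss_avg_def by measurable

lemma gauss_avg_nonneg: "0 \<le> gauss_avg K L x"
  unfolding gauss_avg_def by (intro divide_nonneg_nonneg sum_nonneg) (auto simp: gauss_pos less_imp_le)

lemma gauss_avg_le_1: "gauss_avg K L x \<le> 1"
proof -
  have "(\<Sum>i<K. gauss (L i) x) \<le> (\<Sum>i<K. 1)" by (intro sum_mono gauss_le_1)
  then show ?thesis by (cases "K = 0") (simp_all add: gauss_avg_def divide_le_eq_1)
qed

lemma gauss_avg_fourier_even: "gauss_avg_fourier K L (- \<xi>) = gauss_avg_fourier K L \<xi>"
  by (simp add: gauss_avg_fourier_def gauss_def)

context
  fixes K :: nat and L :: "nat \<Rightarrow> real"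
  assumes L: "\<And>i. L i > 0"
begin

lemma gauss_avg_integrable: "integrable lborel (gauss_avg K L)"
  unfolding gauss_avg_def using L by (auto simp: gauss_integrable)

lemma gauss_avg_square_integrable: "integrable lborel (\<lambda>x. (gauss_avg K L x)\<^sup>2)"
  by (rule Bochner_Integration.integrable_bound[OF gauss_avg_integrable])
    (auto simp: power2_eq_square gauss_avg_nonneg gauss_avg_le_1 intro!: AE_I2 mult_left_le)

lemma fourier_gauss_avg:
  "(LINT x|lborel. gauss_avg K L x * cis (-2 * pi * x * \<xi>)) = complex_of_real (gauss_avg_fourier K L \<xi>)"
proof -
  have int: "integrable lborel (\<lambda>x. gauss (L i) x * cis (-2 * pi * x * \<xi>))" for i
    by (rule Bochner_Integration.integrable_bound[OF gauss_integrable[OF L[of i]]]) (auto simp: norm_mult)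
  have "(LINT x|lborel. gauss_avg K L x * cis (-2 * pi * x * \<xi>)) =
      (LINT x|lborel. (\<Sum>i<K. gauss (L i) x * cis (-2 * pi * x * \<xi>)) / K)"
    by (intro Bochner_Integration.integral_cong refl) (simp add: gauss_avg_def sum_distrib_right)
  also have "\<dots> = (\<Sum>i<K. LINT x|lborel. gauss (L i) x * cis (-2 * pi * x * \<xi>)) / K"
    using int by (subst integral_divide_zero, subst Bochner_Integration.integral_sum) auto
  also have "\<dots> = complex_of_real (gauss_avg_fourier K L \<xi>)"
    unfolding gauss_fourier[OF L] by (simp add: gauss_avg_fourier_def)
  finally show ?thesis .
qed

text \<open>Both squares expand into pairs of scales. On the frequency side the pair
  \<open>i\<close>, \<open>j\<close> gives a Gaussian of width \<open>1 / m i j\<close>, whose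
  integral times \<open>L i * L j\<close> is exactly the position term. So
  \<open>defect_bound\<close> applies pair by pair with weight \<open>L i * L j\<close>: the linear
  part of the defect meets the first absolute moment \<open>(1 / m i j)^2 / pi\<close>, the constant
  part the integral.\<close>

lemma gauss_avg_energy_le:
  assumes [measurable]: "M \<in> sets borel" and M: "M \<subseteq> {0..1}"
    and defect: "\<And>u. shift_defect M u \<le> A * \<bar>u\<bar> + \<delta>"
  shows "measure lborel M * (LINT x|lborel. (gauss_avg K L x)\<^sup>2) -
      (LINT q|(lborel \<Otimes>\<^sub>M lborel). indicator M (fst q) * indicator M (snd q) * (gauss_avg_fourier K L (fst q - snd q))\<^sup>2)
    \<le> (\<Sum>i<K. \<Sum>j<K. A * (L i * L j / ((L i)\<^sup>2 + (L j)\<^sup>2)) / pi + \<delta> * (L i * L j / sqrt ((L i)\<^sup>2 + (L j)\<^sup>2))) / K\<^sup>2"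
proof -
  define m where "m i j = sqrt ((L i)\<^sup>2 + (L j)\<^sup>2)" for i j
  have m: "m i j > 0" "(m i j)\<^sup>2 = (L i)\<^sup>2 + (L j)\<^sup>2" for i j
    using L[of i] by (simp_all add: m_def add_pos_nonneg)
  define J where "J i j = (LINT q|(lborel \<Otimes>\<^sub>M lborel). indicator M (fst q) * indicator M (snd q) * gauss (1 / m i j) (fst q - snd q))" for i j
  have "emeasure lborel M < \<infinity>"
    using emeasure_mono[OF M, of lborel] by (auto intro: le_less_trans)
  then have iM: "integrable lborel (indicator M :: real \<Rightarrow> real)"
    by (intro integrable_real_indicator) auto
  have Jint: "integrable (lborel \<Otimes>\<^sub>M lborel) (\<lambda>q. indicator M (fst q) * indicator M (snd q) * gauss (1 / m i j) (fst q - snd q))" for i j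
    by (rule Bochner_Integration.integrable_bound[OF lborel_pair.integrable_mult_fst_snd[OF iM iM]])
      (auto simp: indicator_def gauss_pos gauss_le_1 less_imp_le)
  have "(LINT x|lborel. (gauss_avg K L x)\<^sup>2) =
      (LINT x|lborel. (\<Sum>i<K. \<Sum>j<K. gauss (L i * L j / m i j) x) / K\<^sup>2)"
    by (intro Bochner_Integration.integral_cong refl)
      (simp add: gauss_avg_def power_divide power2_eq_square[of "sum _ _"] sum_product gauss_mult L m_def)
  also have "\<dots> = (\<Sum>i<K. \<Sum>j<K. L i * L j / m i j) / K\<^sup>2"
    using L m(1) by (simp add: gauss_integrable gauss_integral)
  finally have 1: "(LINT x|lborel. (gauss_avg K L x)\<^sup>2) = (\<Sum>i<K. \<Sum>j<K. L i * L j / m i j) / K\<^sup>2" .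
  have "(LINT q|(lborel \<Otimes>\<^sub>M lborel). indicator M (fst q) * indicator M (snd q) * (gauss_avg_fourier K L (fst q - snd q))\<^sup>2)
    = (LINT q|(lborel \<Otimes>\<^sub>M lborel). (\<Sum>i<K. \<Sum>j<K. L i * L j * 
        (indicator M (fst q) * indicator M (snd q) * gauss (1 / m i j) (fst q - snd q))) / K\<^sup>2)"
    (is "integral\<^sup>L _ ?l = integral\<^sup>L _ ?r")
  proof (intro Bochner_Integration.integral_cong refl)
    fix q :: "real \<times> real"
    define x where "x = fst q - snd q"
    have "(\<Sum>i<K. L i * gauss (1 / L i) x)\<^sup>2 = (\<Sum>i<K. \<Sum>j<K. L i * L j * gauss (1 / m i j) x)"
      unfolding power2_eq_square[of "sum _ _"] sum_product m_def
      by (intro sum.cong refl) (simp add: gauss_mult(2)[OF L L, symmetric])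
    then show "?l q = ?r q"
      by (simp add: gauss_avg_fourier_def power_divide sum_distrib_left mult_ac flip: x_def)
  qed
  also have "\<dots> = (\<Sum>i<K. \<Sum>j<K. L i * L j * J i j) / K\<^sup>2"
    using Jint by (simp add: J_def)
  finally have 2: "(LINT q|(lborel \<Otimes>\<^sub>M lborel). indicator M (fst q) * indicator M (snd q) * (gauss_avg_fourier K L (fst q - snd q))\<^sup>2)
    = (\<Sum>i<K. \<Sum>j<K. L i * L j * J i j) / K\<^sup>2" .
  have J: "measure lborel M * (L i * L j / m i j) - L i * L j * J i j \<le>
      A * (L i * L j / ((L i)\<^sup>2 + (L j)\<^sup>2)) / pi + \<delta> * (L i * L j / m i j)" for i j
  proof -
    have "measure lborel M * (1 / m i j) - J i j \<le> A * ((1 / m i j)\<^sup>2 / pi) + \<delta> * (1 / m i j)"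
      using defect_bound[OF assms(1) M defect, of "gauss (1 / m i j)"] m(1)[of i j]
      by (simp add: J_def gauss_integrable gauss_integral gauss_abs_integrable gauss_abs_integral
          gauss_pos gauss_le_1 less_imp_le)
    then have "(L i * L j) * (measure lborel M * (1 / m i j) - J i j) \<le>
        (L i * L j) * (A * ((1 / m i j)\<^sup>2 / pi) + \<delta> * (1 / m i j))"
      using L[of i] L[of j] by (intro mult_left_mono) auto
    then show ?thesis by (simp add: power_divide m(2) algebra_simps)
  qed
  have "measure lborel M * ((\<Sum>i<K. \<Sum>j<K. L i * L j / m i j) / K\<^sup>2) - (\<Sum>i<K. \<Sum>j<K. L i * L j * J i j) / K\<^sup>2
    = (\<Sum>i<K. \<Sum>j<K. measure lborel M * (L i * L j / m i j) - L i * L j * J i j) / K\<^sup>2"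
    by (simp add: sum_subtractf sum_distrib_left diff_divide_distrib)
  also have "\<dots> \<le> (\<Sum>i<K. \<Sum>j<K. A * (L i * L j / ((L i)\<^sup>2 + (L j)\<^sup>2)) / pi + \<delta> * (L i * L j / m i j)) / K\<^sup>2"
    by (intro divide_right_mono sum_mono J) auto
  finally show ?thesis unfolding 1 2 m_def .
qed

end

text \<open>The linear part decays with the distance of the scales, so each row sums to at most
  \<open>4 * A\<close>, and division by \<open>K^2\<close> leaves a factor \<open>1 / K\<close>. For
  the constant part every pair is simply charged with \<open>2 ^ (n + K)\<close>, a bound for the
  largest scale.\<close>

lemma dyadic_energy_le:
  fixes n K :: nat and A \<delta> :: real
  assumes "0 \<le> A" "0 \<le> \<delta>" "K > 0"
  defines "L \<equiv> \<lambda>i. (2::real) ^ (n + i)"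
  shows "(\<Sum>i<K. \<Sum>j<K. A * (L i * L j / ((L i)\<^sup>2 + (L j)\<^sup>2)) / pi + \<delta> * (L i * L j / sqrt ((L i)\<^sup>2 + (L j)\<^sup>2))) / K\<^sup>2
    \<le> 4 * A / K + \<delta> * 2 ^ (n + K)"
proof -
  have t: "A * (L i * L j / ((L i)\<^sup>2 + (L j)\<^sup>2)) / pi + \<delta> * (L i * L j / sqrt ((L i)\<^sup>2 + (L j)\<^sup>2))
     \<le> A * ((1/2) ^ (i - j) * (1/2) ^ (j - i)) + \<delta> * 2 ^ (n + K)" if "i < K" for i j
  proof (rule add_mono)
    have "A * (L i * L j / ((L i)\<^sup>2 + (L j)\<^sup>2)) / pi \<le> A * (L i * L j / ((L i)\<^sup>2 + (L j)\<^sup>2)) / 1"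
      using assms pi_ge_two by (intro divide_left_mono mult_nonneg_nonneg divide_nonneg_nonneg add_nonneg_nonneg) (auto simp: L_def)
    also have "\<dots> \<le> A * ((1/2) ^ (i - j) * (1/2) ^ (j - i))"
      unfolding L_def using mult_left_mono[OF dyadic_product_bounds(1)[of n i j] assms(1)] by simp
    finally show "A * (L i * L j / ((L i)\<^sup>2 + (L j)\<^sup>2)) / pi \<le> A * ((1/2) ^ (i - j) * (1/2) ^ (j - i))" .
    have "L i * L j / sqrt ((L i)\<^sup>2 + (L j)\<^sup>2) \<le> L i" unfolding L_def by (rule dyadic_product_bounds(2))
    also have "\<dots> \<le> 2 ^ (n + K)" unfolding L_def using that by (intro power_increasing) auto
    finally show "\<delta> * (L i * L j / sqrt ((L i)\<^sup>2 + (L j)\<^sup>2)) \<le> \<delta> * 2 ^ (n + K)"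
      using assms by (intro mult_left_mono)
  qed
  have "(\<Sum>i<K. \<Sum>j<K. A * (L i * L j / ((L i)\<^sup>2 + (L j)\<^sup>2)) / pi + \<delta> * (L i * L j / sqrt ((L i)\<^sup>2 + (L j)\<^sup>2)))
    \<le> (\<Sum>i<K. \<Sum>j<K. A * ((1/2) ^ (i - j) * (1/2) ^ (j - i)) + \<delta> * 2 ^ (n + K))"
    by (intro sum_mono t) auto
  also have "\<dots> = (\<Sum>i<K. A * (\<Sum>j<K. (1/2) ^ (i - j) * (1/2) ^ (j - i)) + K * (\<delta> * 2 ^ (n + K)))"
    by (simp add: sum.distrib sum_distrib_left)
  also have "\<dots> \<le> (\<Sum>i<K. A * 4 + K * (\<delta> * 2 ^ (n + K)))"
    using assms by (intro sum_mono add_mono mult_left_mono two_sided_geometric_sum_le) auto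
  also have "\<dots> = K * (A * 4 + K * (\<delta> * 2 ^ (n + K)))" by simp
  finally have "(\<Sum>i<K. \<Sum>j<K. A * (L i * L j / ((L i)\<^sup>2 + (L j)\<^sup>2)) / pi + \<delta> * (L i * L j / sqrt ((L i)\<^sup>2 + (L j)\<^sup>2))) / K\<^sup>2
     \<le> K * (A * 4 + K * (\<delta> * 2 ^ (n + K))) / K\<^sup>2"
    by (intro divide_right_mono) auto
  also have "\<dots> = 4 * A / K + \<delta> * 2 ^ (n + K)"
    using assms(3) by (simp add: power2_eq_square field_simps)
  finally show ?thesis .
qed

text \<open>The determinantal identity is for test functions of bounded support, which Gaussians
  lack. Cutting off changes the variance formula by little: since the kernel is bounded by 1,
  \<open>F^2\<close> and the product of the absolute values of \<open>F\<close> dominate.\<close>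

lemma truncated_variance_tendsto:
  fixes F :: "real \<Rightarrow> real" and K :: "real \<Rightarrow> real \<Rightarrow> complex"
  assumes K [measurable]: "(\<lambda>p. K (fst p) (snd p)) \<in> borel_measurable (lborel \<Otimes>\<^sub>M lborel)"
    and K_le: "\<And>s t. norm (K s t) \<le> 1"
    and F: "integrable lborel F" and F2: "integrable lborel (\<lambda>t. (F t)\<^sup>2)"
  defines "f \<equiv> \<lambda>R t. F t * indicator {-real R..real R} t"
  shows "(\<lambda>R::nat. (LINT t|lborel. complex_of_real ((f R t)\<^sup>2) * K t t) -
       (LINT p|(lborel \<Otimes>\<^sub>M lborel). complex_of_real (f R (fst p) * f R (snd p)) * (K (fst p) (snd p) * K (snd p) (fst p))))
    \<longlonglongrightarrow> (LINT t|lborel. (F t)\<^sup>2 * K t t) -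
       (LINT p|(lborel \<Otimes>\<^sub>M lborel). F (fst p) * F (snd p) * (K (fst p) (snd p) * K (snd p) (fst p)))"
proof -
  have Kdiag [measurable]: "(\<lambda>t. K t t) \<in> borel_measurable borel"
    using measurable_compose[OF _ K, of "\<lambda>t. (t, t)" borel] by simp
  have Kflip [measurable]: "(\<lambda>p. K (snd p) (fst p)) \<in> borel_measurable (lborel \<Otimes>\<^sub>M lborel)"
    using measurable_compose[OF _ K, of "\<lambda>p. (snd p, fst p)" "lborel \<Otimes>\<^sub>M lborel"] by simp
  have [measurable]: "F \<in> borel_measurable borel" using F by simp
  have [measurable]: "f R \<in> borel_measurable borel" for R unfolding f_def by measurable
  have f_lim: "(\<lambda>R. f R t) \<longlonglongrightarrow> F t" for t
  proof (rule tendsto_eventually)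
    obtain N :: nat where N: "\<bar>t\<bar> \<le> real N" using real_arch_simple by blast
    show "eventually (\<lambda>R. f R t = F t) sequentially"
      using eventually_ge_at_top[of N] by eventually_elim (use N in \<open>auto simp: f_def indicator_def\<close>)
  qed
  have f_abs: "\<bar>f R t\<bar> \<le> \<bar>F t\<bar>" for R t by (simp add: f_def indicator_def)
  have KK: "norm (K s t * K t s) \<le> 1" for s t using K_le by (simp add: norm_mult mult_le_one)
  show ?thesis
  proof (intro tendsto_diff integral_dominated_convergence)
    show "integrable lborel (\<lambda>t. (F t)\<^sup>2)" by (rule F2)
    show "AE t in lborel. norm (complex_of_real ((f R t)\<^sup>2) * K t t) \<le> (F t)\<^sup>2" for R
    proof (rule AE_I2)
      fix t
      have "norm (complex_of_real ((f R t)\<^sup>2) * K t t) \<le> (f R t)\<^sup>2 * 1"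
        unfolding norm_mult using K_le by (intro mult_mono) (auto simp: norm_power)
      also have "\<dots> \<le> (F t)\<^sup>2" using f_abs[of R t] by (simp add: abs_le_square_iff)
      finally show "norm (complex_of_real ((f R t)\<^sup>2) * K t t) \<le> (F t)\<^sup>2" .
    qed
    show "AE t in lborel. (\<lambda>R. complex_of_real ((f R t)\<^sup>2) * K t t) \<longlonglongrightarrow> complex_of_real ((F t)\<^sup>2) * K t t"
      by (intro AE_I2 tendsto_intros f_lim)
    show "integrable (lborel \<Otimes>\<^sub>M lborel) (\<lambda>p. \<bar>F (fst p)\<bar> * \<bar>F (snd p)\<bar>)"
      using F by (intro lborel_pair.integrable_mult_fst_snd integrable_abs)
    show "AE p in lborel \<Otimes>\<^sub>M lborel. norm (complex_of_real (f R (fst p) * f R (snd p)) * (K (fst p) (snd p) * K (snd p) (fst p)))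
       \<le> \<bar>F (fst p)\<bar> * \<bar>F (snd p)\<bar>" for R
    proof (rule AE_I2)
      fix p :: "real \<times> real"
      have "norm (complex_of_real (f R (fst p) * f R (snd p)) * (K (fst p) (snd p) * K (snd p) (fst p)))
         \<le> \<bar>f R (fst p) * f R (snd p)\<bar> * 1"
        unfolding norm_mult[of "complex_of_real _"] using KK by (intro mult_mono) (auto simp: norm_mult abs_mult)
      also have "\<dots> \<le> \<bar>F (fst p)\<bar> * \<bar>F (snd p)\<bar>"
        unfolding abs_mult using f_abs by (simp add: mult_mono)
      finally show "norm (complex_of_real (f R (fst p) * f R (snd p)) * (K (fst p) (snd p) * K (snd p) (fst p)))
         \<le> \<bar>F (fst p)\<bar> * \<bar>F (snd p)\<bar>" .
    qed
    show "AE p in lborel \<Otimes>\<^sub>M lborel. (\<lambda>R. complex_of_real (f R (fst p) * f R (snd p)) * (K (fst p) (snd p) * K (snd p) (fst p)))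
        \<longlonglongrightarrow> complex_of_real (F (fst p) * F (snd p)) * (K (fst p) (snd p) * K (snd p) (fst p))"
      by (intro AE_I2 tendsto_intros f_lim)
  qed measurable
qed

text \<open>With \<open>n\<close>-th stage length sum \<open>\<theta> + (1 - \<theta>) gap_tail n\<close>, the error \<open>gap_tail n\<close> stays negligible
  even when multiplied by the largest scale \<open>2 ^ (n + 4 ^ n)\<close>.\<close>

definition gap_tail :: "nat \<Rightarrow> real" where
  "gap_tail n = (1/2) ^ (16 ^ n - 1)"

text \<open>For \<open>n \<ge> 1\<close> the exponents satisfy
  \<open>2 * n + 4 ^ n \<le> 16 ^ n - 1\<close>, because \<open>16 ^ n\<close> is at least
  \<open>4 * 4 ^ n\<close> and \<open>n < 4 ^ n\<close>. The factor 2 on the right is for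
  \<open>n = 0\<close>, where \<open>gap_tail 0 = 1\<close> and the left side equals 2.\<close>

lemma gap_tail_bound: "gap_tail n * 2 ^ (n + 4 ^ n) \<le> 2 * (1/2) ^ n"
proof (cases "n = 0")
  case False
  have "n < 4 ^ n" by (rule power_gt_expt) simp
  moreover have "(4::nat) ^ 1 \<le> 4 ^ n" using False by (intro power_increasing) auto
  then have "4 * 4 ^ n \<le> (4::nat) ^ n * 4 ^ n" by (intro mult_right_mono) auto
  moreover have "(16::nat) ^ n = 4 ^ n * 4 ^ n" by (simp flip: power_mult_distrib)
  ultimately have "16 ^ n - 1 \<ge> (n + 4 ^ n) + n" by linarith
  then obtain d where d: "16 ^ n - 1 = (n + 4 ^ n) + n + d" using le_Suc_ex by blast
  have "gap_tail n * 2 ^ (n + 4 ^ n) = (1/2) ^ n * (1/2) ^ d"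
    unfolding gap_tail_def d power_add by (simp add: power_one_over)
  also have "\<dots> \<le> 2 * (1/2) ^ n"
    using power_le_one[of "1/2::real" d] by (simp add: mult_left_le order_trans[OF mult_left_le])
  finally show ?thesis .
qed (simp add: gap_tail_def)

text \<open>Level \<open>n\<close> uses \<open>4 ^ n\<close> scales starting at
  \<open>2 ^ n\<close>. The linear part of the defect then costs
  \<open>4 * (2 ^ n + 1) / 4 ^ n\<close> and the constant part at most \<open>2 * (1/2) ^ n\<close>,
  so the variances vanish in the limit. The \<open>+ 1\<close> in the hypothesis leaves room for the
  endpoints of \<open>[0,1]\<close> when \<open>M\<close> is a complement.\<close>

theorem number_rigid_of_small_defect:
  assumes [measurable]: "M \<in> sets borel" and M: "M \<subseteq> {0..1}"
    and defect: "\<And>n u. shift_defect M u \<le> (2 ^ n + 1) * \<bar>u\<bar> + gap_tail n"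
    and P: "determinantal (fourier_kernel M) P"
  shows "number_rigid P"
proof -
  let ?K = "fourier_kernel M"
  define L where "L n i = (2::real) ^ (n + i)" for n i :: nat
  have L: "L n i > 0" for n i by (simp add: L_def)
  define F where "F n = gauss_avg (4 ^ n) (L n)" for n
  define f where "f n R t = F n t * indicator {-real R..real R} t" for n R t
  \<comment> \<open>\<open>v n R\<close> will be an actual variance, that of the truncation
    \<open>f n R\<close>. \<open>v' n\<close> is the same formula for \<open>F n\<close>, whose
    support is unbounded, and is used only as the limit of \<open>v n R\<close>.\<close>
  define v where "v n R = (LINT t|lborel. (f n R t)\<^sup>2 * ?K t t) -
       (LINT p|(lborel \<Otimes>\<^sub>M lborel). f n R (fst p) * f n R (snd p) * (?K (fst p) (snd p) * ?K (snd p) (fst p)))" for n R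
  define v' where "v' n = (LINT t|lborel. (F n t)\<^sup>2 * ?K t t) -
       (LINT p|(lborel \<Otimes>\<^sub>M lborel). F n (fst p) * F n (snd p) * (?K (fst p) (snd p) * ?K (snd p) (fst p)))" for n
  note Kmeas = fourier_kernel_measurable[OF assms(1)]
  note Kle = fourier_kernel_norm[OF assms(1) M]
  have F01: "0 \<le> F n t" "F n t \<le> 1" for n t by (simp_all add: F_def gauss_avg_nonneg gauss_avg_le_1)
  have [measurable]: "F n \<in> borel_measurable borel" for n by (simp add: F_def)
  have [measurable]: "f n R \<in> borel_measurable borel" for n R unfolding f_def by measurable
  have v_lim: "v n \<longlonglongrightarrow> v' n" for n
    unfolding v_def v'_def f_def F_def
    by (rule truncated_variance_tendsto[OF Kmeas Kle gauss_avg_integrable[OF L] gauss_avg_square_integrable[OF L]])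
  have v'_le: "Re (v' n) \<le> 4 * (2 ^ n + 1) / 4 ^ n + 2 * (1/2) ^ n" for n
  proof -
    let ?E = "measure lborel M * (LINT x|lborel. (F n x)\<^sup>2) -
      (LINT q|(lborel \<Otimes>\<^sub>M lborel). indicator M (fst q) * indicator M (snd q) * (gauss_avg_fourier (4 ^ n) (L n) (fst q - snd q))\<^sup>2)"
    have "v' n = complex_of_real ?E"
      unfolding v'_def F_def
        kernel_energy_fourier[OF assms(1) M gauss_avg_integrable[OF L] fourier_gauss_avg[OF L] gauss_avg_fourier_even]
        fourier_kernel_diag[OF assms(1)]
      by (simp flip: of_real_power)
    then have "Re (v' n) = ?E" by simp
    also have "\<dots> \<le> 4 * (2 ^ n + 1) / real (4 ^ n) + gap_tail n * 2 ^ (n + 4 ^ n)"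
      unfolding F_def
      by (rule order_trans[OF gauss_avg_energy_le[OF L assms(1) M defect[of _ n]]], unfold L_def, rule dyadic_energy_le)
        (auto simp: gap_tail_def)
    also have "\<dots> \<le> 4 * (2 ^ n + 1) / 4 ^ n + 2 * (1/2) ^ n"
      using gap_tail_bound[of n] by simp
    finally show ?thesis .
  qed
  \<comment> \<open>The cut-off radius is large enough for the variance to be nearly that of
    \<open>F n\<close>, and at least \<open>n\<close>, so that each point is eventually
    inside.\<close>
  have "\<exists>R. R \<ge> n \<and> Re (v n R) \<le> Re (v' n) + 1 / (real n + 1)" for n
  proof -
    have "(\<lambda>R. Re (v n R)) \<longlonglongrightarrow> Re (v' n)" by (intro tendsto_Re v_lim)
    then have "eventually (\<lambda>R. Re (v n R) < Re (v' n) + 1 / (real n + 1)) sequentially"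
      by (rule order_tendstoD) simp
    then have "eventually (\<lambda>R. R \<ge> n \<and> Re (v n R) \<le> Re (v' n) + 1 / (real n + 1)) sequentially"
      using eventually_ge_at_top[of n] by eventually_elim simp
    then show ?thesis using eventually_happens' sequentially_bot by blast
  qed
  then obtain R where R: "\<And>n. R n \<ge> n" "\<And>n. Re (v n (R n)) \<le> Re (v' n) + 1 / (real n + 1)"
    by metis
  define g where "g n = f n (R n)" for n
  have g01: "0 \<le> g n t" "g n t \<le> 1" for n t using F01 by (auto simp: g_def f_def indicator_def)
  have gsupp: "g n t = 0" if "\<bar>t\<bar> > real (R n)" for n t using that by (auto simp: g_def f_def indicator_def)
  \<comment> \<open>Bundles the conclusions of \<open>determinantal_variance\<close>, so that
    centring constants and versions \<open>V\<close> can be chosen for all \<open>n\<close> at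
    once.\<close>
  define Q where "Q n c V \<longleftrightarrow> integrable P V \<and>
      (AE X in P. V X = (enn2real (\<integral>\<^sup>+t. ennreal (g n t) \<partial>config_measure X) - c)\<^sup>2) \<and>
      complex_of_real (LINT X|P. V X) = v n (R n)" for n c V
  have "\<exists>c V. Q n c V" for n
  proof -
    have [measurable]: "g n \<in> borel_measurable borel" unfolding g_def by measurable
    obtain c V where "integrable P V"
      "AE X in P. V X = (enn2real (\<integral>\<^sup>+t. ennreal (g n t) \<partial>config_measure X) - c)\<^sup>2"
      "complex_of_real (LINT X|P. V X) = v n (R n)"
      unfolding v_def g_def[symmetric]
      by (rule determinantal_variance[OF P Kmeas Kle, of "g n" "real (R n)"]) (use g01 gsupp in auto)
    then show ?thesis unfolding Q_def by blast
  qed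
  then obtain c V where "\<And>n. Q n (c n) (V n)" by metis
  then have V: "\<And>n. integrable P (V n)"
    "\<And>n. AE X in P. V n X = (enn2real (\<integral>\<^sup>+t. ennreal (g n t) \<partial>config_measure X) - c n)\<^sup>2"
    "\<And>n. complex_of_real (LINT X|P. V n X) = v n (R n)"
    by (simp_all only: Q_def)
  show ?thesis
  proof (rule number_rigid_criterion)
    show "simple_process P" using P by (simp add: determinantal_def)
    show "g n \<in> borel_measurable borel" for n by (simp add: g_def)
    show "0 \<le> g n t" for n t by (rule g01)
    show "g n t = 0" if "\<bar>t\<bar> > real (R n)" for n t using that by (rule gsupp)
    show "integrable P (V n)" for n by (rule V)
    show "AE X in P. V n X = (enn2real (\<integral>\<^sup>+t. ennreal (g n t) \<partial>config_measure X) - c n)\<^sup>2" for n by (rule V)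
    show "(\<lambda>n. LINT X|P. V n X) \<longlonglongrightarrow> 0"
    proof (rule tendsto_sandwich)
      show "\<forall>\<^sub>F n in sequentially. 0 \<le> (LINT X|P. V n X)"
      proof (intro always_eventually allI)
        show "0 \<le> (LINT X|P. V n X)" for n
          by (rule integral_nonneg_AE) (use V(2)[of n] in eventually_elim, simp)
      qed
      show "\<forall>\<^sub>F n in sequentially. (LINT X|P. V n X) \<le> 4 * (2 ^ n + 1) / 4 ^ n + 2 * (1/2) ^ n + 1 / (real n + 1)"
      proof (intro always_eventually allI)
        fix n
        have "(LINT X|P. V n X) = Re (v n (R n))" using arg_cong[OF V(3)[of n], of Re] by simp
        then show "(LINT X|P. V n X) \<le> 4 * (2 ^ n + 1) / 4 ^ n + 2 * (1/2) ^ n + 1 / (real n + 1)"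
          using R(2)[of n] v'_le[of n] by linarith
      qed
      have "(\<lambda>n. 4 * (1/2) ^ n + 4 * (1/4) ^ n + 2 * (1/2) ^ n + inverse (real (Suc n))) \<longlonglongrightarrow>
          4 * 0 + 4 * 0 + 2 * 0 + 0"
        by (intro tendsto_intros LIMSEQ_power_zero LIMSEQ_inverse_real_of_nat) auto
      moreover have "4 * (2 ^ n + 1) / 4 ^ n = 4 * (1/2) ^ n + 4 * (1/4 :: real) ^ n" for n
      proof -
        have "(4::real) ^ n = 2 ^ n * 2 ^ n" by (simp flip: power_mult_distrib)
        then show ?thesis by (simp add: power_one_over field_simps)
      qed
      ultimately show "(\<lambda>n. 4 * (2 ^ n + 1) / 4 ^ n + 2 * (1/2) ^ n + 1 / (real n + 1)) \<longlonglongrightarrow> 0"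
        by (simp add: inverse_eq_divide add.commute)
    qed simp
    \<comment> \<open>All scales at level \<open>n\<close> are at least \<open>2 ^ n\<close>, so
      once \<open>t\<close> is inside the cut-off the average is at least the narrowest Gaussian,
      which tends to 1.\<close>
    show "(\<lambda>n. g n t) \<longlonglongrightarrow> 1" for t
    proof (rule tendsto_sandwich)
      obtain N :: nat where N: "\<bar>t\<bar> \<le> real N" using real_arch_simple by blast
      show "\<forall>\<^sub>F n in sequentially. gauss (2 ^ n) t \<le> g n t"
        using eventually_ge_at_top[of N]
      proof eventually_elim
        case (elim n)
        then have "\<bar>t\<bar> \<le> real (R n)" using N R(1)[of n] by linarith
        then have "g n t = F n t" by (auto simp: g_def f_def indicator_def)
        moreover have "(\<Sum>i<(4::nat) ^ n. gauss (2 ^ n) t) \<le> (\<Sum>i<(4::nat) ^ n. gauss (L n i) t)"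
        proof (rule sum_mono)
          fix i
          have "(2 ^ n)\<^sup>2 \<le> (L n i)\<^sup>2" unfolding L_def by (intro power_mono power_increasing) auto
          then have "pi * t\<^sup>2 / (L n i)\<^sup>2 \<le> pi * t\<^sup>2 / (2 ^ n)\<^sup>2"
            using L[of n i] by (intro divide_left_mono) auto
          then show "gauss (2 ^ n) t \<le> gauss (L n i) t" by (simp add: gauss_def)
        qed
        ultimately have "gauss (2 ^ n) t * 4 ^ n \<le> g n t * 4 ^ n"
          by (simp add: F_def gauss_avg_def mult.commute)
        then show ?case by (rule mult_right_le_imp_le) simp
      qed
      show "\<forall>\<^sub>F n in sequentially. g n t \<le> 1" using g01 by simp
      have "(\<lambda>n. exp (- pi * t\<^sup>2 * (1/4) ^ n)) \<longlonglongrightarrow> exp (- pi * t\<^sup>2 * 0)"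
        by (intro tendsto_intros LIMSEQ_power_zero) auto
      moreover have "gauss (2 ^ n) t = exp (- pi * t\<^sup>2 * (1/4) ^ n)" for n
      proof -
        have "(2 ^ n)\<^sup>2 = (4::real) ^ n" by (simp flip: power_mult power_mult_distrib add: power2_eq_square)
        then show ?thesis by (simp add: gauss_def power_one_over)
      qed
      ultimately show "(\<lambda>n. gauss (2 ^ n) t) \<longlonglongrightarrow> 1" by simp
    qed simp
  qed
qed

text \<open>When \<open>s - u\<close> is not in the complement, either it leaves the unit interval,
  which confines \<open>s\<close> to a piece of length |u|, or it lies in \<open>C\<close>. In the
  second case \<open>s\<close> is in \<open>?B\<close>, and moving \<open>?B\<close> by
  \<open>- u\<close> gives the points of \<open>C\<close> that leave \<open>C\<close> when
  \<open>u\<close> is added: the defect at \<open>- u\<close>.\<close>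

lemma shift_defect_complement:
  assumes [measurable]: "C \<in> sets borel" and C: "C \<subseteq> {0..1}"
  shows "shift_defect ({0..1} - C) u \<le> \<bar>u\<bar> + shift_defect C (- u)"
proof -
  let ?J = "if u \<ge> 0 then {0..u} else {1 + u..1}" and ?B = "{s. s \<notin> C \<and> s - u \<in> C}"
  have vimage: "(+) u -` ?B = {s \<in> C. s - (- u) \<notin> C}"
    by (auto simp: add.commute)
  have "emeasure lborel ?B = emeasure (distr lborel borel ((+) u)) ?B"
    by (simp only: lborel_distr_plus)
  also have "\<dots> = emeasure lborel {s \<in> C. s - (- u) \<notin> C}"
    by (subst emeasure_distr) (simp_all only: vimage, auto)
  finally have B: "emeasure lborel ?B = emeasure lborel {s \<in> C. s - (- u) \<notin> C}" .
  have "emeasure lborel {s \<in> C. s - (- u) \<notin> C} \<le> emeasure lborel {0..1::real}"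
    using C by (intro emeasure_mono) auto
  then have "?B \<in> fmeasurable lborel"
    unfolding fmeasurable_def using B by (auto intro: le_less_trans)
  have "shift_defect ({0..1} - C) u \<le> measure lborel (?J \<union> ?B)"
    unfolding shift_defect_def
  proof (rule measure_mono_fmeasurable)
    show "{s \<in> {0..1} - C. s - u \<notin> {0..1} - C} \<subseteq> ?J \<union> ?B" by auto
    show "?J \<union> ?B \<in> fmeasurable lborel"
      using \<open>?B \<in> fmeasurable lborel\<close> by (intro fmeasurable.Un) (auto simp: fmeasurable_def emeasure_lborel_Icc_eq)
  qed measurable
  also have "\<dots> \<le> measure lborel ?J + measure lborel ?B"
    by (rule measure_Un_le) auto
  also have "measure lborel ?J = \<bar>u\<bar>" by auto
  also have "measure lborel ?B = shift_defect C (- u)"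
    unfolding shift_defect_def measure_def B ..
  finally show ?thesis by simp
qed

theorem theorem1p2:
  fixes \<theta> :: real
  assumes "0 \<le> \<theta>" and "\<theta> < 1"
  shows "\<exists>C I. generalized_cantor_set C \<and> measure lebesgue C = \<theta> \<and> I = {0..1} - C \<and>
           (\<forall>P. determinantal (fourier_kernel C) P \<longrightarrow> number_rigid P) \<and>
           (\<forall>P. determinantal (fourier_kernel I) P \<longrightarrow> number_rigid P)"
proof -
  \<comment> \<open>These are the conditions of \<open>cantor_set_exists\<close> on the error
    sequence, which is taken to be \<open>gap_tail\<close>.\<close>
  have "gap_tail 0 = 1" by (simp add: gap_tail_def)
  moreover have "0 < gap_tail n" for n by (simp add: gap_tail_def)
  moreover have "gap_tail (Suc n) < gap_tail n" for n
  proof -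
    have "(16::nat) ^ n - 1 < 16 ^ Suc n - 1" by (intro diff_less_mono) auto
    then show ?thesis unfolding gap_tail_def by (intro power_strict_decreasing) auto
  qed
  moreover have "gap_tail \<longlonglongrightarrow> 0"
  proof (rule tendsto_sandwich)
    show "\<forall>\<^sub>F n in sequentially. 0 \<le> gap_tail n" by (simp add: gap_tail_def)
    show "\<forall>\<^sub>F n in sequentially. gap_tail n \<le> 2 * (1/2) ^ n"
    proof (intro always_eventually allI)
      fix n
      have "gap_tail n * 1 \<le> gap_tail n * 2 ^ (n + 4 ^ n)"
        by (intro mult_left_mono one_le_power) (auto simp: gap_tail_def)
      then show "gap_tail n \<le> 2 * (1/2) ^ n" using gap_tail_bound[of n] by simp
    qed
    show "(\<lambda>n. 2 * (1/2 :: real) ^ n) \<longlonglongrightarrow> 0"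
      by (intro tendsto_mult_right_zero LIMSEQ_power_zero) simp
  qed simp
  ultimately obtain C where C: "generalized_cantor_set C" "C \<in> sets borel" "C \<subseteq> {0..1}" "measure lborel C = \<theta>"
    and defect: "\<And>n u. shift_defect C u \<le> 2 ^ n * \<bar>u\<bar> + gap_tail n"
    using cantor_set_exists[OF assms, of gap_tail] by metis
  have "measure lebesgue C = \<theta>"
    using C(2,4) by simp
  moreover have "number_rigid P" if "determinantal (fourier_kernel C) P" for P
  proof (rule number_rigid_of_small_defect[OF C(2,3) _ that])
    show "shift_defect C u \<le> (2 ^ n + 1) * \<bar>u\<bar> + gap_tail n" for n u
      using defect[of u n] by (simp add: algebra_simps)
  qed
  moreover have "number_rigid P" if "determinantal (fourier_kernel ({0..1} - C)) P" for P
  proof (rule number_rigid_of_small_defect[OF _ _ _ that])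
    show "{0..1} - C \<in> sets borel" using C(2) by auto
    \<comment> \<open>The bound for \<open>C\<close> depends only on the absolute value of
      \<open>u\<close>, so it holds at \<open>- u\<close>, and the extra |u| is absorbed by the
      \<open>+ 1\<close>.\<close>
    show "shift_defect ({0..1} - C) u \<le> (2 ^ n + 1) * \<bar>u\<bar> + gap_tail n" for n u
      using shift_defect_complement[OF C(2,3), of u] defect[of "- u" n] by (simp add: algebra_simps)
  qed auto
  ultimately show ?thesis using C(1) by blast
qed

end
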